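(* Let $\alpha\ge 0$ be fixed and, for $p>1$, let $u^1_p$ be the positive least energy radial solution of $$-\Delta u=|x|^{\alpha}|u|^{p-1}u \ \text{ in } B,\qquad u=0 \ \text{ on }\partial B .$$ Set $\mu_p=|u^1_p(0)|$, $\rho_p=(p\,\mu_p^{p-1})^{-\frac{1}{2+\alpha}}$ and $$\widetilde u_p(x)=\frac{p\,(u^1_p(\rho_p x)-u^1_p(0))}{u^1_p(0)},\qquad |x|<1/\rho_p .$$ Then, as $p\to\infty$, $\mu_p\to\sqrt e$, $\rho_p\to 0$, and $$\widetilde u_p(x)\to \log\frac{4(2+\alpha)^4}{\big(2(2+\alpha)^2+|x|^{2+\alpha}\big)^2}\quad\text{in } C^1_{\mathrm{loc}}(\mathbb R^2).$$
   Context: $B$ is the open unit disc of $\mathbb R^2$ centred at the origin. A least energy radial solution is a minimizer of the energy $\mathcal E(u)=\frac12\int_B|\nabla u|^2-\frac1{p+1}\int_B|x|^\alpha|u|^{p+1}$ on the radial Nehari set $\{v\in H^1_{0}(B)\text{ radial},\ v\neq0,\ \int_B|\nabla v|^2=\int_B|x|^\alpha|v|^{p+1}\}$; it is a classical solution, unique up to sign, and $u^1_p$ denotes the positive one (its only critical point is the origin, where it attains its maximum). *)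

theory Defs
  imports "HOL-Analysis.Analysis"
begin

definition grad :: "(real^2 \<Rightarrow> real) \<Rightarrow> real^2 \<Rightarrow> real^2" where
  "grad f x = (\<chi> i. frechet_derivative f (at x) (axis i 1))"

definition radial :: "(real^2 \<Rightarrow> real) \<Rightarrow> bool" where
  "radial v \<longleftrightarrow> (\<forall>x y. norm x = norm y \<longrightarrow> v x = v y)"

definition radial_nehari :: "real \<Rightarrow> real \<Rightarrow> (real^2 \<Rightarrow> real) \<Rightarrow> bool" where
  "radial_nehari \<alpha> p v \<longleftrightarrow>
     radial v \<and>
     continuous_on (cball 0 1) v \<and>
     v differentiable_on ball 0 1 \<and>
     continuous_on (ball 0 1) (grad v) \<and>
     (\<forall>x. norm x = 1 \<longrightarrow> v x = 0) \<and>
     set_integrable lborel (ball 0 1) (\<lambda>x. (norm (grad v x))^2) \<and>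
     (\<exists>x\<in>ball 0 1. v x \<noteq> 0) \<and>
     (LINT x : ball 0 1 | lborel. (norm (grad v x))^2)
       = (LINT x : ball 0 1 | lborel. norm x powr \<alpha> * \<bar>v x\<bar> powr (p + 1))"

definition energy :: "real \<Rightarrow> real \<Rightarrow> (real^2 \<Rightarrow> real) \<Rightarrow> real" where
  "energy \<alpha> p v =
     (1/2) * (LINT x : ball 0 1 | lborel. (norm (grad v x))^2)
     - (1/(p + 1)) * (LINT x : ball 0 1 | lborel. norm x powr \<alpha> * \<bar>v x\<bar> powr (p + 1))"

definition least_energy_radial :: "real \<Rightarrow> real \<Rightarrow> (real^2 \<Rightarrow> real) \<Rightarrow> bool" where
  "least_energy_radial \<alpha> p u \<longleftrightarrow>
     radial_nehari \<alpha> p u \<and> (\<forall>v. radial_nehari \<alpha> p v \<longrightarrow> energy \<alpha> p u \<le> energy \<alpha> p v)"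

definition pos_least_energy_radial :: "real \<Rightarrow> real \<Rightarrow> (real^2 \<Rightarrow> real) \<Rightarrow> bool" where
  "pos_least_energy_radial \<alpha> p u \<longleftrightarrow>
     least_energy_radial \<alpha> p u \<and> (\<forall>x\<in>ball 0 1. u x > 0)"

end

theory Submission
  imports Defs "HOL-Real_Asymp.Real_Asymp"
begin

text \<open>
  A least energy solution minimizes the quotient of the Dirichlet integral by the power
  \<open>2 / (p + 1)\<close> of the weighted \<open>L\<^bsup>p+1\<^esup>\<close> integral, so its radial profile solves
  \<open>- (r \<phi>')' = r\<^bsup>1+\<alpha>\<^esup> \<phi>\<^bsup>p\<^esup>\<close>.  After rescaling, with \<open>a = 2 + \<alpha>\<close> and \<open>L = 1 / \<rho>\<close>, one gets \<open>f\<close> on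
  \<open>[0, L]\<close> with \<open>f(0) = 0\<close>, \<open>f(L) = - p\<close>, and the flux \<open>m = - R f'\<close> satisfies \<open>m' = R\<^bsup>a-1\<^esup> w\<^bsup>p\<^esup>\<close>, where
  \<open>w = 1 + f / p\<close>.  A Pohozaev-type comparison of \<open>R m'\<close> with \<open>a m - m\<^sup>2 / 2\<close> pinches \<open>m\<close> between
  \<open>R\<^bsup>a\<^esup> / (a + c R\<^bsup>a\<^esup> / (2 a))\<close> and \<open>R\<^bsup>a\<^esup> / (a + R\<^bsup>a\<^esup> / (2 a))\<close> as long as \<open>1 / w \<le> c\<close>.  On compact sets
  \<open>c \<rightarrow> 1\<close>, which is the convergence to the bubble.  On the whole interval \<open>m \<le> 2 a\<close>, and \<open>m\<close> is
  close to \<open>2 a\<close> beyond \<open>R\<^bsup>a\<^esup> = \<surd>p\<close>, so \<open>p = - f(L)\<close> is asymptotic to \<open>2 a ln L\<close>; as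
  \<open>L\<^bsup>a\<^esup> = p \<mu>\<^bsup>p-1\<^esup>\<close>, this gives \<open>ln \<mu> \<rightarrow> 1 / 2\<close>.
\<close>

section \<open>Radial functions on the unit disc\<close>

text \<open>On the half-line above \<open>x\<close> both measures give the area of an annulus; Borel
  measures that are finite and equal on all such half-lines coincide.\<close>

lemma distr_norm_unit_disc:
  "distr (density lborel (indicator (ball 0 1))) borel (norm :: real^2 \<Rightarrow> real) =
   density lborel (\<lambda>r. ennreal (2 * pi * r * indicator {0..1} r))"  (is "?M = ?N")
proof (rule measure_eqI_lessThan)
  have M: "emeasure ?M {x<..} = emeasure lborel (ball (0::real^2) 1 - cball 0 x)" for x
  proof -
    have [measurable]: "ball (0::real^2) 1 \<in> sets borel" "cball (0::real^2) x \<in> sets borel" by auto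
    have eq: "norm -` {x<..} = - cball (0::real^2) x"
      by (auto simp: )
    have "emeasure ?M {x<..} = emeasure (density lborel (indicator (ball (0::real^2) 1))) (- cball 0 x)"
      by (subst emeasure_distr) (auto simp: eq)
    also have "\<dots> = (\<integral>\<^sup>+y. indicator (ball 0 1) y * indicator (- cball (0::real^2) x) y \<partial>lborel)"
      by (subst emeasure_density) auto
    also have "\<dots> = (\<integral>\<^sup>+y. indicator (ball 0 1 - cball (0::real^2) x) y \<partial>lborel)"
      by (intro nn_integral_cong) (auto split: split_indicator)
    also have "\<dots> = emeasure lborel (ball (0::real^2) 1 - cball 0 x)"
      by (subst nn_integral_indicator) auto
    finally show ?thesis .
  qed
  have b1: "emeasure lborel (ball (0::real^2) 1) = ennreal pi"
    by (simp add: emeasure_ball unit_ball_vol_2)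
  show "emeasure ?M {x<..} < \<infinity>" for x
  proof -
    have "emeasure ?M {x<..} \<le> emeasure lborel (ball (0::real^2) 1)"
      unfolding M by (intro emeasure_mono) auto
    also have "\<dots> < \<infinity>" by (simp add: b1)
    finally show ?thesis .
  qed
  show "emeasure ?M {x<..} = emeasure ?N {x<..}" for x
  proof -
    \<comment> \<open>Clamping \<open>x\<close> to the unit interval makes the area
      \<open>pi - pi * y^2\<close> correct for every \<open>x\<close>.\<close>
    define y where "y = max 0 (min 1 x)"
    have y: "0 \<le> y" "y \<le> 1" by (auto simp: y_def)
    have c: "emeasure lborel (cball (0::real^2) y) = ennreal (pi * y^2)"
      using y by (subst emeasure_cball) (auto simp: unit_ball_vol_2)
    have "emeasure lborel (ball (0::real^2) 1 - cball 0 x) = ennreal (pi - pi * y^2)"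
    proof (cases "x < 1")
      case False
      then have e: "ball (0::real^2) 1 - cball 0 x = {}" and "y = 1" by (auto simp: y_def)
      then show ?thesis unfolding e by simp
    next
      case x1: True
      show ?thesis
      proof (cases "x < 0")
        case True
        then have "ball (0::real^2) 1 - cball 0 x = ball 0 1" "y = 0" by (auto simp: y_def)
        then show ?thesis by (simp add: b1)
      next
        case False
        then have yx: "y = x" using x1 by (auto simp: y_def)
        have "emeasure lborel (ball (0::real^2) 1 - cball 0 x) =
            emeasure lborel (ball (0::real^2) 1) - emeasure lborel (cball (0::real^2) x)"
          using x1 c yx by (intro emeasure_Diff) auto
        also have "\<dots> = ennreal (pi - pi * y^2)"
          using b1 c yx by (simp add: ennreal_minus)
        finally show ?thesis .
      qed
    qed
    moreover have "emeasure ?N {x<..} = ennreal (pi - pi * y^2)"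
    proof -
      have "emeasure ?N {x<..} =
          (\<integral>\<^sup>+r. ennreal (2 * pi * r * indicator {0..1} r) * indicator {x<..} r \<partial>lborel)"
        by (subst emeasure_density) auto
      \<comment> \<open>The two integrands can differ only at the single point
        \<open>y\<close>.\<close>
      also have "\<dots> = (\<integral>\<^sup>+r. ennreal (2 * pi * r) * indicator {y..1} r \<partial>lborel)"
        by (intro nn_integral_cong_AE, use AE_lborel_singleton[of y] in eventually_elim)
           (auto split: split_indicator simp: y_def)
      also have "\<dots> = ennreal (pi * 1^2 - pi * y^2)"
        using y by (intro nn_integral_FTC_Icc)
          (auto intro!: derivative_eq_intros)
      finally show ?thesis by simp
    qed
    ultimately show ?thesis unfolding M by simp
  qed
qed auto

text \<open>Continuity of \<open>g\<close> at \<open>0\<close> is not required because \<open>r powr 0\<close> jumps there (\<open>0 powr 0 = 0\<close>).\<close>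

lemma polar_unit_disc:
  fixes g :: "real \<Rightarrow> real"
  assumes g: "continuous_on {0<..1} g" and rg: "continuous_on {0..1} (\<lambda>r. r * g r)"
  shows "set_integrable lborel (ball 0 1) (\<lambda>x::real^2. g (norm x))"
    and "(LINT x : ball (0::real^2) 1 | lborel. g (norm x)) = 2 * pi * integral {0..1} (\<lambda>r. r * g r)"
proof -
  define g' where "g' r = indicator {0..1} r *\<^sub>R g r" for r
  \<comment> \<open>Measurability is checked with the origin split off, since \<open>g\<close> may
    jump there.\<close>
  have "(\<lambda>r. indicator {0<..1} r *\<^sub>R g r + indicator {0} r *\<^sub>R g 0) \<in> borel_measurable borel"
    using borel_measurable_continuous_on_indicator[OF _ g] by simp
  also have "(\<lambda>r. indicator {0<..1} r *\<^sub>R g r + indicator {0} r *\<^sub>R g 0) = g'"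
    by (auto simp: g'_def split: split_indicator)
  finally have [measurable]: "g' \<in> borel_measurable borel" .
  have eq: "indicator (ball 0 1) x *\<^sub>R g (norm x) = indicator (ball 0 1) x * g' (norm x)"
    for x :: "real^2" by (auto simp: g'_def split: split_indicator)
  have [measurable]: "ball (0::real^2) 1 \<in> sets borel" by auto
  have rg': "continuous_on {0..1} (\<lambda>r. 2 * pi * r * g r)"
    using continuous_on_mult_left[OF rg, of "2 * pi"] by (simp add: mult.assoc)
  have I: "set_integrable lborel {0..1} (\<lambda>r. 2 * pi * r * g r)"
    unfolding set_integrable_def by (rule borel_integrable_compact[OF _ rg']) auto
  have dens: "density lborel (indicator (ball (0::real^2) 1)) =
      density lborel (\<lambda>x. ennreal (indicator (ball 0 1) x))"
    by (intro density_cong) (auto split: split_indicator)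
  have J: "integrable lborel (\<lambda>r. (2 * pi * r * indicator {0..1} r) *\<^sub>R g' r)"
    using I unfolding set_integrable_def
    by (rule back_subst[of "integrable lborel"]) (auto simp: g'_def split: split_indicator)
  then have "integrable (density lborel (\<lambda>r. ennreal (2 * pi * r * indicator {0..1} r))) g'"
    by (subst integrable_density) (auto split: split_indicator)
  then have "integrable (distr (density lborel (indicator (ball 0 1))) borel (norm :: real^2 \<Rightarrow> real)) g'"
    by (simp add: distr_norm_unit_disc)
  then have "integrable (density lborel (indicator (ball 0 1))) (\<lambda>x::real^2. g' (norm x))"
    by (subst (asm) integrable_distr_eq) auto
  then have "integrable lborel (\<lambda>x::real^2. indicator (ball 0 1) x *\<^sub>R g' (norm x))"
    unfolding dens by (subst (asm) integrable_density) auto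
  then show "set_integrable lborel (ball 0 1) (\<lambda>x::real^2. g (norm x))"
    unfolding set_integrable_def eq by simp
  have "(LINT x : ball (0::real^2) 1 | lborel. g (norm x)) =
      (LINT x | density lborel (indicator (ball (0::real^2) 1)). g' (norm x))"
    unfolding set_lebesgue_integral_def eq dens by (subst integral_density) auto
  also have "\<dots> = (LINT r | distr (density lborel (indicator (ball 0 1))) borel (norm :: real^2 \<Rightarrow> real). g' r)"
    by (subst integral_distr) auto
  also have "\<dots> = (LINT r | lborel. (2 * pi * r * indicator {0..1} r) *\<^sub>R g' r)"
    unfolding distr_norm_unit_disc by (subst integral_density) (auto split: split_indicator)
  also have "\<dots> = (LINT r : {0..1} | lborel. 2 * pi * r * g r)"
    unfolding set_lebesgue_integral_def
    by (intro Bochner_Integration.integral_cong) (auto simp: g'_def split: split_indicator)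
  also have "\<dots> = integral {0..1} (\<lambda>r. 2 * pi * r * g r)"
    by (rule set_borel_integral_eq_integral(2)[OF I])
  also have "\<dots> = 2 * pi * integral {0..1} (\<lambda>r. r * g r)"
    by (subst integral_mult_right[symmetric]) (simp add: mult.assoc)
  finally show "(LINT x : ball (0::real^2) 1 | lborel. g (norm x)) = 2 * pi * integral {0..1} (\<lambda>r. r * g r)" .
qed

section \<open>Gradients of radial functions\<close>

lemma grad_eqI:
  assumes "(v has_derivative (\<lambda>h. g \<bullet> h)) (at x)"
  shows "grad v x = g"
  by (simp add: grad_def vec_eq_iff inner_axis frechet_derivative_at[OF assms, symmetric])

lemma has_derivative_grad:
  assumes "v differentiable (at x)"
  shows "(v has_derivative (\<lambda>h. grad v x \<bullet> h)) (at x)"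
proof -
  have d: "(v has_derivative frechet_derivative v (at x)) (at x)"
    using assms by (simp add: frechet_derivative_works)
  interpret linear "frechet_derivative v (at x)" using d by (rule has_derivative_linear)
  have "frechet_derivative v (at x) h = grad v x \<bullet> h" for h
  proof -
    have "h = (\<Sum>i\<in>UNIV. h $ i *\<^sub>R axis i 1)" by (simp add: basis_expansion scalar_mult_eq_scaleR[symmetric])
    then have "frechet_derivative v (at x) h = (\<Sum>i\<in>UNIV. h $ i *\<^sub>R frechet_derivative v (at x) (axis i 1))"
      by (metis (no_types, lifting) sum scale sum.cong)
    also have "\<dots> = grad v x \<bullet> h" by (simp add: grad_def inner_vec_def mult.commute)
    finally show ?thesis .
  qed
  then have "frechet_derivative v (at x) = (\<lambda>h. grad v x \<bullet> h)" by blast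
  with d show ?thesis by metis
qed

text \<open>The norm takes only nonnegative values, so a one-sided derivative of the profile
  suffices. At the origin zero slope rules out a conical tip, and \<open>sgn 0 = 0\<close> lets one
  formula cover both cases.\<close>

lemma has_derivative_radial:
  fixes v :: "'a::real_inner \<Rightarrow> real"
  assumes eq: "\<And>y. y \<in> ball 0 L \<Longrightarrow> v y = f (norm y)"
    and x: "x \<in> ball 0 L"
    and f: "(f has_real_derivative d) (at (norm x) within {0..})"
    and d0: "x = 0 \<Longrightarrow> d = 0"
  shows "(v has_derivative (\<lambda>h. (d *\<^sub>R sgn x) \<bullet> h)) (at x)"
proof -
  have "((\<lambda>y. f (norm y)) has_derivative (\<lambda>h. (d *\<^sub>R sgn x) \<bullet> h)) (at x)"
  proof (cases "x = 0")
    case False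
    have "(norm has_derivative (\<lambda>h. sgn x \<bullet> h)) (at x)"
      using has_derivative_norm[OF False] by (simp add: inner_commute)
    moreover have "(f has_derivative (\<lambda>h. d * h)) (at (norm x) within range norm)"
      using f by (auto simp: has_field_derivative_def intro: has_derivative_subset)
    ultimately have "((\<lambda>y. f (norm y)) has_derivative (\<lambda>h. d * (sgn x \<bullet> h))) (at x)"
      by (rule has_derivative_in_compose)
    then show ?thesis by simp
  next
    case True
    have "((\<lambda>y. (f y - f 0) / y) \<longlongrightarrow> 0) (at 0 within {0..})"
      using f d0 True by (simp add: has_field_derivative_iff)
    then have "((\<lambda>y. norm ((f y - f 0) / y)) \<longlongrightarrow> 0) (at 0 within {0..})"
      by (rule tendsto_norm_zero)
    moreover have "filterlim (norm :: 'a \<Rightarrow> real) (at 0 within {0..}) (at 0)"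
      unfolding filterlim_at by (auto simp: eventually_at_filter intro!: tendsto_norm_zero tendsto_ident_at)
    ultimately have "((\<lambda>y::'a. norm ((f (norm y) - f 0) / norm y)) \<longlongrightarrow> 0) (at 0)"
      by (rule filterlim_compose)
    then show ?thesis using True d0 by (simp add: has_derivative_iff_norm)
  qed
  then show ?thesis
    by (rule has_derivative_transform_within_open[OF _ open_ball x]) (simp add: eq)
qed

section \<open>The variational problem in radial form\<close>

text \<open>Convexity of the power, read off from Young's inequality with the conjugate exponents
  \<open>(p + 1) / p\<close> and \<open>p + 1\<close>.\<close>

lemma powr_tangent_le:
  fixes x y p :: real
  assumes "0 < x" "0 < p"
  shows "x powr (p + 1) + (p + 1) * x powr p * (y - x) \<le> \<bar>y\<bar> powr (p + 1)"
proof -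
  have "x powr p * \<bar>y\<bar> \<le> (x powr p) powr ((p + 1) / p) / ((p + 1) / p) + \<bar>y\<bar> powr (p + 1) / (p + 1)"
    using assms by (intro Youngs_inequality) (auto simp: field_simps)
  also have "(x powr p) powr ((p + 1) / p) = x powr (p + 1)"
    using assms by (simp add: powr_powr)
  also have "x powr (p + 1) / ((p + 1) / p) + \<bar>y\<bar> powr (p + 1) / (p + 1) =
      (p * x powr (p + 1) + \<bar>y\<bar> powr (p + 1)) / (p + 1)"
    by (simp only: divide_divide_eq_right add_divide_distrib[of _ _ "p + 1"] mult.commute)
  finally have "(p + 1) * (x powr p * \<bar>y\<bar>) \<le> p * x powr (p + 1) + \<bar>y\<bar> powr (p + 1)"
    using assms by (subst (asm) pos_le_divide_eq) (auto simp: mult.commute)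
  moreover have "(p + 1) * (x powr p * y) \<le> (p + 1) * (x powr p * \<bar>y\<bar>)"
    using assms by (intro mult_left_mono) auto
  moreover have "x powr (p + 1) = x powr p * x" using assms by (simp add: powr_add)
  ultimately show ?thesis by (simp add: algebra_simps)
qed

locale positive_least_energy =
  fixes \<alpha> p :: real and u :: "real^2 \<Rightarrow> real"
  assumes alpha: "0 \<le> \<alpha>" and p: "1 < p" and ple: "pos_least_energy_radial \<alpha> p u"
begin

text \<open>The profile is taken along a whole diameter, so that derivatives at the origin are
  two-sided and evenness forces \<open>phi' 0 = 0\<close>.\<close>

definition phi :: "real \<Rightarrow> real" where "phi r = u (r *\<^sub>R axis 1 1)"
definition phi' :: "real \<Rightarrow> real" where "phi' r = grad u (r *\<^sub>R axis 1 1) $ 1"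

definition dirichlet :: "(real^2 \<Rightarrow> real) \<Rightarrow> real" where
  "dirichlet v = (LINT x : ball 0 1 | lborel. (norm (grad v x))^2)"
definition mass :: "(real^2 \<Rightarrow> real) \<Rightarrow> real" where
  "mass v = (LINT x : ball 0 1 | lborel. norm x powr \<alpha> * \<bar>v x\<bar> powr (p + 1))"

lemma nehari: "radial_nehari \<alpha> p u"
  using ple by (simp add: pos_least_energy_radial_def least_energy_radial_def)

lemma u_eq: "u x = phi (norm x)"
proof -
  have "radial u" using nehari by (simp add: radial_nehari_def)
  moreover have "norm x = norm (norm x *\<^sub>R axis 1 1 :: real^2)" by simp
  ultimately show ?thesis unfolding radial_def phi_def by blast
qed

lemma phi_has_derivative:
  assumes "\<bar>r\<bar> < 1"
  shows "(phi has_real_derivative phi' r) (at r)"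
proof -
  let ?e = "axis 1 1 :: real^2"
  have "r *\<^sub>R ?e \<in> ball 0 1" using assms by simp
  then have "u differentiable (at (r *\<^sub>R ?e))"
    using nehari differentiable_on_eq_differentiable_at[OF open_ball]
    unfolding radial_nehari_def by blast
  then have 1: "(u has_derivative (\<lambda>h. grad u (r *\<^sub>R ?e) \<bullet> h)) (at (r *\<^sub>R ?e))"
    by (rule has_derivative_grad)
  have "((\<lambda>r. u (r *\<^sub>R ?e)) has_derivative (\<lambda>h. grad u (r *\<^sub>R ?e) \<bullet> (h *\<^sub>R ?e))) (at r)"
    by (rule has_derivative_compose[where f = "\<lambda>r. r *\<^sub>R ?e" and x = r and g = u, OF _ 1]) (auto intro!: derivative_eq_intros)
  then show ?thesis
    unfolding has_field_derivative_def phi_def[abs_def] phi'_def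
    by (simp add: inner_axis mult.commute[of _ "grad u (r *\<^sub>R ?e) $ 1"])
qed

lemma phi_minus: "phi (- r) = phi r"
  using u_eq[of "(-r) *\<^sub>R axis 1 1"] u_eq[of "r *\<^sub>R axis 1 1"] by (simp add: phi_def)

lemma phi'_0 [simp]: "phi' 0 = 0"
proof -
  have 0: "(phi has_real_derivative phi' 0) (at 0)" by (rule phi_has_derivative) simp
  then have "((\<lambda>r. phi (- r)) has_real_derivative - phi' 0) (at 0)"
    using DERIV_mirror[of phi "phi' 0" 0] by simp
  then have "(phi has_real_derivative - phi' 0) (at 0)" by (simp add: phi_minus)
  from DERIV_unique[OF 0 this] show ?thesis by simp
qed

lemma phi'_cont: "continuous_on {-1<..<1} phi'"
  unfolding phi'_def
proof (rule continuous_on_component, rule continuous_on_compose2[of "ball 0 1" "grad u"])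
  show "continuous_on (ball 0 1) (grad u)" using nehari by (simp add: radial_nehari_def)
qed (auto intro!: continuous_intros simp: abs_less_iff)

lemma phi_cont: "continuous_on {0..1} phi"
  unfolding phi_def
proof (rule continuous_on_compose2[of "cball 0 1" u])
  show "continuous_on (cball 0 1) u" using nehari by (simp add: radial_nehari_def)
qed (auto intro!: continuous_intros)

lemma phi_pos: "0 \<le> r \<Longrightarrow> r < 1 \<Longrightarrow> 0 < phi r"
  using ple by (auto simp: pos_least_energy_radial_def phi_def)

lemma phi_1: "phi 1 = 0"
  using nehari by (simp add: radial_nehari_def phi_def)

lemma phi_nonneg: "0 \<le> r \<Longrightarrow> r \<le> 1 \<Longrightarrow> 0 \<le> phi r"
  using phi_pos[of r] phi_1 by (cases "r = 1") (auto intro: less_imp_le)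

lemma u_has_derivative:
  assumes "x \<in> ball 0 1"
  shows "(u has_derivative (\<lambda>h. (phi' (norm x) *\<^sub>R sgn x) \<bullet> h)) (at x)"
  by (rule has_derivative_radial[where L = 1 and f = phi])
     (use assms in \<open>auto simp: u_eq intro!: has_field_derivative_at_within phi_has_derivative\<close>)

lemma weight_cont: "continuous_on {0<..1} (\<lambda>r. r powr \<alpha>)"
  by (intro continuous_intros) auto

lemma weight'_cont: "continuous_on {0..1} (\<lambda>r. r powr (1 + \<alpha>))"
  using alpha by (intro continuous_on_powr' continuous_intros) auto

lemma weight_polar:
  fixes g :: "real \<Rightarrow> real"
  assumes g: "continuous_on {0..1} g"
  shows "set_integrable lborel (ball 0 1) (\<lambda>x::real^2. norm x powr \<alpha> * g (norm x))"
    and "(LINT x : ball (0::real^2) 1 | lborel. norm x powr \<alpha> * g (norm x)) =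
      2 * pi * integral {0..1} (\<lambda>r. r powr (1 + \<alpha>) * g r)"
proof -
  have eq: "r powr (1 + \<alpha>) * g r = r * (r powr \<alpha> * g r)" if "0 \<le> r" for r
    using that by (simp add: powr_add)
  have 1: "continuous_on {0<..1} (\<lambda>r. r powr \<alpha> * g r)"
    by (intro continuous_on_mult weight_cont continuous_on_subset[OF g]) auto
  have "continuous_on {0..1} (\<lambda>r. r powr (1 + \<alpha>) * g r)"
    by (intro continuous_on_mult weight'_cont g)
  then have 2: "continuous_on {0..1} (\<lambda>r. r * (r powr \<alpha> * g r))"
    by (rule continuous_on_eq) (simp add: eq)
  show "set_integrable lborel (ball 0 1) (\<lambda>x::real^2. norm x powr \<alpha> * g (norm x))"
    by (rule polar_unit_disc[OF 1 2])
  have "integral {0..1} (\<lambda>r. r * (r powr \<alpha> * g r)) = integral {0..1} (\<lambda>r. r powr (1 + \<alpha>) * g r)"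
    by (intro integral_cong) (simp add: eq)
  with polar_unit_disc(2)[OF 1 2]
  show "(LINT x : ball (0::real^2) 1 | lborel. norm x powr \<alpha> * g (norm x)) =
      2 * pi * integral {0..1} (\<lambda>r. r powr (1 + \<alpha>) * g r)" by simp
qed

lemma dirichlet_eq_mass: "dirichlet u = mass u"
  using nehari by (simp add: radial_nehari_def dirichlet_def mass_def)

lemma phi_powr_cont: "0 < q \<Longrightarrow> continuous_on {0..1} (\<lambda>r. phi r powr q)"
  by (intro continuous_on_powr' phi_cont continuous_intros) (auto simp: phi_nonneg)

lemma mass_u: "mass u = (LINT x : ball (0::real^2) 1 | lborel. norm x powr \<alpha> * phi (norm x) powr (p + 1))"
proof -
  have "\<bar>u x\<bar> = phi (norm x)" if "x \<in> ball 0 1" for x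
    using that phi_nonneg[of "norm x"] u_eq[of x] by simp
  then show ?thesis unfolding mass_def by (intro set_lebesgue_integral_cong) auto
qed

lemma mass_pos: "0 < mass u"
proof -
  let ?f = "\<lambda>r. r powr (1 + \<alpha>) * phi r powr (p + 1)"
  have c: "continuous_on {0..1} ?f" using p by (intro continuous_on_mult weight'_cont phi_powr_cont) auto
  have "0 \<le> integral {0..1} ?f" by (intro integral_nonneg integrable_continuous_interval c) auto
  moreover have "integral {0..1} ?f \<noteq> 0"
  proof
    assume "integral {0..1} ?f = 0"
    then have "\<forall>x\<in>{0..1}. ?f x = 0" by (subst (asm) integral_eq_0_iff[OF c]) auto
    then have "?f (1/2) = 0" by (rule bspec) simp
    with phi_pos[of "1/2"] show False by simp
  qed
  moreover have "mass u = 2 * pi * integral {0..1} ?f"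
    by (rule trans[OF mass_u weight_polar(2)[OF phi_powr_cont]]) (use p in simp)
  ultimately show ?thesis using pi_gt_zero by (simp add: less_le)
qed

section \<open>The Nehari constraint and the Rayleigh quotient\<close>

lemma energy_u: "energy \<alpha> p u = (1/2 - 1/(p+1)) * mass u"
  using dirichlet_eq_mass by (simp add: energy_def dirichlet_def mass_def algebra_simps)

text \<open>A suitable multiple of \<open>v\<close> lies on the Nehari set, where the energy is a
  fixed positive multiple of the Dirichlet integral. Minimality of \<open>u\<close> thus becomes the
  scale-invariant statement that \<open>u\<close> minimizes
  \<open>dirichlet v / mass v powr (2 / (p + 1))\<close>, which can be tested with unconstrained
  variations.\<close>

lemma rayleigh_quotient_le:
  assumes v: "radial v" "continuous_on (cball 0 1) v" "v differentiable_on ball 0 1"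
      "continuous_on (ball 0 1) (grad v)" "\<And>x. norm x = 1 \<Longrightarrow> v x = 0"
      "set_integrable lborel (ball 0 1) (\<lambda>x. (norm (grad v x))^2)"
    and D: "0 < dirichlet v" and N: "0 < mass v"
  shows "mass u * (mass v / mass u) powr (2 / (p + 1)) \<le> dirichlet v"
proof -
  \<comment> \<open>This factor solves \<open>s^2 * dirichlet v = s powr (p + 1) * mass v\<close>,
    the Nehari condition for \<open>s * v\<close>.\<close>
  define s where "s = (dirichlet v / mass v) powr (1 / (p - 1))"
  have s: "0 < s" using D N by (simp add: s_def)
  have sp: "s powr (p - 1) = dirichlet v / mass v" using D N p by (simp add: s_def powr_powr)
  define w where "w x = s * v x" for x
  have gw: "grad w x = s *\<^sub>R grad v x" if "x \<in> ball 0 1" for x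
  proof (rule grad_eqI)
    have "v differentiable (at x)"
      using v(3) that differentiable_on_eq_differentiable_at[OF open_ball] by blast
    from has_derivative_grad[OF this]
    show "(w has_derivative (\<bullet>) (s *\<^sub>R grad v x)) (at x)"
      unfolding w_def by (auto intro!: derivative_eq_intros)
  qed
  have Dw_eq: "(norm (grad w x))^2 = s^2 * (norm (grad v x))^2" if "x \<in> ball 0 1" for x
    using gw[OF that] by (simp add: power_mult_distrib)
  have Dw: "dirichlet w = s^2 * dirichlet v"
  proof -
    have "dirichlet w = (LINT x : ball 0 1 | lborel. s^2 * (norm (grad v x))^2)"
      unfolding dirichlet_def by (intro set_lebesgue_integral_cong) (auto simp: Dw_eq)
    then show ?thesis by (simp add: dirichlet_def)
  qed
  have Nw: "mass w = s powr (p + 1) * mass v"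
  proof -
    have "mass w = (LINT x : ball 0 1 | lborel. s powr (p + 1) * (norm x powr \<alpha> * \<bar>v x\<bar> powr (p + 1)))"
      unfolding mass_def using s
      by (intro set_lebesgue_integral_cong) (auto simp: w_def abs_mult powr_mult)
    then show ?thesis by (simp add: mass_def)
  qed
  have "s powr (p + 1) = s powr (p - 1) * s powr 2" by (simp add: add.commute flip: powr_add)
  then have eq: "dirichlet w = mass w" unfolding Dw Nw sp using s N by simp
  have "radial_nehari \<alpha> p w"
    unfolding radial_nehari_def
  proof (intro conjI)
    show "radial w" using v(1) unfolding radial_def w_def by metis
    show "continuous_on (cball 0 1) w" unfolding w_def by (intro continuous_intros v)
    show "w differentiable_on ball 0 1" unfolding w_def by (intro derivative_intros v)
    have "continuous_on (ball 0 1) (\<lambda>x. s *\<^sub>R grad v x)" by (intro continuous_intros v)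
    then show "continuous_on (ball 0 1) (grad w)" by (rule continuous_on_eq) (simp add: gw)
    show "\<forall>x. norm x = 1 \<longrightarrow> w x = 0" using v(5) by (simp add: w_def)
    have "set_integrable lborel (ball 0 1) (\<lambda>x. s^2 * (norm (grad v x))^2)"
      using v(6) by (rule set_integrable_mult_right)
    then show "set_integrable lborel (ball 0 1) (\<lambda>x. (norm (grad w x))^2)"
      by (subst set_integrable_cong[OF refl refl Dw_eq]) auto
    show "\<exists>x\<in>ball 0 1. w x \<noteq> 0"
    proof (rule ccontr)
      assume "\<not> ?thesis"
      then have "mass v = (LINT x : ball (0::real^2) 1 | lborel. 0)"
        unfolding mass_def using s by (intro set_lebesgue_integral_cong) (auto simp: w_def)
      then show False using N by simp
    qed
    show "(LINT x : ball 0 1 | lborel. (norm (grad w x))^2)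
       = (LINT x : ball 0 1 | lborel. norm x powr \<alpha> * \<bar>w x\<bar> powr (p + 1))"
      using eq by (simp add: dirichlet_def mass_def)
  qed
  then have "energy \<alpha> p u \<le> energy \<alpha> p w"
    using ple by (simp add: pos_least_energy_radial_def least_energy_radial_def)
  moreover have "energy \<alpha> p w = (1/2 - 1/(p+1)) * dirichlet w"
    using eq by (simp add: energy_def dirichlet_def mass_def algebra_simps)
  moreover have "1/2 - 1/(p+1) > 0" using p by (simp add: field_simps)
  ultimately have "mass u \<le> s^2 * dirichlet v" by (simp add: energy_u Dw)
  \<comment> \<open>Logarithms make the elimination of \<open>s\<close> a linear
    computation.\<close>
  then have "ln (mass u) \<le> ln (s^2 * dirichlet v)" using mass_pos s D by (subst ln_le_cancel_iff) auto
  also have "\<dots> = 2 * ((ln (dirichlet v) - ln (mass v)) / (p - 1)) + ln (dirichlet v)"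
    using s D N by (simp add: ln_mult ln_realpow s_def ln_powr ln_div)
  finally have "(p - 1) * ln (mass u) \<le> (p + 1) * ln (dirichlet v) - 2 * ln (mass v)"
    using p by (simp add: field_simps)
  then have "ln (mass u) + 2 / (p + 1) * (ln (mass v) - ln (mass u)) \<le> ln (dirichlet v)"
    using p by (simp add: field_simps)
  then have "ln (mass u * (mass v / mass u) powr (2 / (p + 1))) \<le> ln (dirichlet v)"
    using mass_pos N by (simp add: ln_mult ln_powr ln_div)
  then show ?thesis using mass_pos N D by (subst (asm) ln_le_cancel_iff) auto
qed

end

section \<open>The radial differential equation\<close>

text \<open>\<open>sgn\<close> is discontinuous only at the origin, where the vanishing of
  \<open>g\<close> compensates. This yields the continuous gradient required of a competitor
  \<open>u + t P\<close>.\<close>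

lemma continuous_on_radial_field:
  fixes g :: "real \<Rightarrow> real"
  assumes g: "continuous_on {0..1} g" and g0: "g 0 = 0"
  shows "continuous_on (ball (0::'a::real_normed_vector) 1) (\<lambda>x. g (norm x) *\<^sub>R sgn x)"
proof -
  have gn: "continuous_on (ball (0::'a) 1) (\<lambda>x. g (norm x))"
    by (rule continuous_on_compose2[OF g]) (auto intro!: continuous_intros)
  have "isCont (\<lambda>x. g (norm x) *\<^sub>R sgn x) x" if x: "x \<in> ball 0 1" for x :: 'a
  proof -
    have gx: "isCont (\<lambda>x::'a. g (norm x)) x"
      using gn x continuous_on_eq_continuous_at[OF open_ball] by blast
    show ?thesis
    proof (cases "x = 0")
      case False
      then show ?thesis by (intro continuous_intros gx) auto
    next
      case True
      then have "((\<lambda>x::'a. g (norm x)) \<longlongrightarrow> 0) (at 0)"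
        using gx g0 by (simp add: isCont_def)
      then have "((\<lambda>x::'a. g (norm x) *\<^sub>R sgn x) \<longlongrightarrow> 0) (at 0)"
        by (rule Lim_null_comparison[rotated, OF tendsto_rabs_zero])
           (auto simp: norm_sgn intro!: always_eventually)
      with True show ?thesis by (simp add: isCont_def)
    qed
  qed
  then show ?thesis by (simp add: continuous_at_imp_continuous_on)
qed

context positive_least_energy
begin

text \<open>The convexity of \<open>y \<mapsto> \<bar>y\<bar>\<^bsup>p+1\<^esup>\<close> bounds the mass of \<open>u + t P\<close> from below by an affine function of \<open>t\<close>,
  so the mass never has to be differentiated under the integral sign.\<close>

lemma euler_lagrange:
  fixes P G :: "real \<Rightarrow> real"
  assumes G: "continuous_on {0..1} G" "G 0 = 0"
    and P: "\<And>r. r \<in> {0..1} \<Longrightarrow> (P has_real_derivative G r) (at r)" "P 1 = 0"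
    and pG: "continuous_on {0..1} (\<lambda>r. phi' r * G r)"
  shows "integral {0..1} (\<lambda>r. r * (phi' r * G r)) =
    integral {0..1} (\<lambda>r. r powr (1 + \<alpha>) * (phi r powr p * P r))"
proof -
  let ?B = "ball (0::real^2) 1"
  define E where "E = mass u"
  define I where "I = (LINT x : ?B | lborel. phi' (norm x) * G (norm x))"
  define K where "K = (LINT x : ?B | lborel. (G (norm x))^2)"
  define J where "J = (LINT x : ?B | lborel. norm x powr \<alpha> * (phi (norm x) powr p * P (norm x)))"
  have E0: "0 < E" using mass_pos by (simp add: E_def)
  have Pc: "continuous_on {0..1} P"
    using P(1) by (meson DERIV_isCont continuous_at_imp_continuous_on)
  have c_id: "continuous_on {0..1} (\<lambda>r. r * g r)" "continuous_on {0<..1} g"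
    if "continuous_on {0..1} g" for g :: "real \<Rightarrow> real"
    using that by (auto intro!: continuous_intros intro: continuous_on_subset)
  have cG2: "continuous_on {0..1} (\<lambda>r. (G r)^2)" by (intro continuous_intros G)
  have cJ: "continuous_on {0..1} (\<lambda>r. phi r powr p * P r)"
    using p by (intro continuous_on_mult phi_powr_cont Pc) auto
  \<comment> \<open>\<open>phi'\<close> is not known to extend continuously to 1: the cross term is
    integrable by \<open>pG\<close>, the Dirichlet term (\<open>intD\<close>) by membership in the
    Nehari set.\<close>
  note intI = polar_unit_disc[OF c_id(2,1)[OF pG]]
  note intK = polar_unit_disc(1)[OF c_id(2,1)[OF cG2]]
  note intJ = weight_polar[OF cJ]
  have grad_u: "grad u x = phi' (norm x) *\<^sub>R sgn x" if "x \<in> ?B" for x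
    by (rule grad_eqI[OF u_has_derivative[OF that]])
  have norm_grad_u: "(norm (grad u x))^2 = (phi' (norm x))^2" if "x \<in> ?B" for x
    using grad_u[OF that] by (auto simp: norm_sgn)
  have intD: "set_integrable lborel ?B (\<lambda>x. (phi' (norm x))^2)"
    using nehari unfolding radial_nehari_def
    by (subst set_integrable_cong[OF refl refl norm_grad_u[symmetric]]) auto
  have E_D: "E = (LINT x : ?B | lborel. (phi' (norm x))^2)"
    unfolding E_def dirichlet_eq_mass[symmetric] dirichlet_def
    by (intro set_lebesgue_integral_cong) (auto simp: norm_grad_u)
  have cE: "continuous_on {0..1} (\<lambda>r. phi r powr (p + 1))" using p by (intro phi_powr_cont) auto
  \<comment> \<open>The quotient inequality for \<open>u + t P\<close>, with its mass replaced by
    the affine lower bound; since the power is monotone, this only decreases the left side.\<close>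
  have key: "E * ((E + t * ((p + 1) * J)) / E) powr (2 / (p + 1)) \<le> E + 2 * t * I + t^2 * K"
    if D: "0 < E + 2 * t * I + t^2 * K" and N: "0 < E + t * ((p + 1) * J)" for t
  proof -
    define v where "v x = u x + t * P (norm x)" for x :: "real^2"
    have v_der: "(v has_derivative (\<lambda>h. ((phi' (norm x) + t * G (norm x)) *\<^sub>R sgn x) \<bullet> h)) (at x)"
      if "x \<in> ?B" for x
    proof (rule has_derivative_radial[where L = 1 and f = "\<lambda>r. phi r + t * P r"])
      show "((\<lambda>r. phi r + t * P r) has_real_derivative phi' (norm x) + t * G (norm x)) (at (norm x) within {0..})"
        using that by (intro has_field_derivative_at_within[OF DERIV_add] DERIV_cmult phi_has_derivative P) auto
    qed (use that G in \<open>auto simp: v_def u_eq\<close>)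
    note grad_v = grad_eqI[OF v_der]
    have norm_grad_v: "(norm (grad v x))^2 =
        (phi' (norm x))^2 + ((2 * t) * (phi' (norm x) * G (norm x)) + t^2 * (G (norm x))^2)"
      if "x \<in> ?B" for x
    proof -
      have "(norm (grad v x))^2 = (phi' (norm x) + t * G (norm x))^2"
        using grad_v[OF that] G(2) by (auto simp: norm_sgn)
      then show ?thesis by (simp add: power2_eq_square algebra_simps)
    qed
    have int_v: "set_integrable lborel ?B (\<lambda>x. (norm (grad v x))^2)"
      by (subst set_integrable_cong[OF refl refl norm_grad_v])
         (auto intro!: set_integral_add set_integrable_mult_right intD intI intK)
    have D_v: "dirichlet v = E + 2 * t * I + t^2 * K"
    proof -
      have "dirichlet v = (LINT x : ?B | lborel. (phi' (norm x))^2 +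
          ((2 * t) * (phi' (norm x) * G (norm x)) + t^2 * (G (norm x))^2))"
        unfolding dirichlet_def by (intro set_lebesgue_integral_cong) (auto simp: norm_grad_v)
      also have "\<dots> = E + ((2 * t) * I + t^2 * K)"
        using intD intI(1) intK
        by (subst set_integral_add set_integral_mult_right, simp_all add: set_integral_add E_D I_def K_def)+
      finally show ?thesis by simp
    qed
    have N_v: "E + t * ((p + 1) * J) \<le> mass v"
    proof -
      have "E + t * ((p + 1) * J) = (LINT x : ?B | lborel. norm x powr \<alpha> * phi (norm x) powr (p + 1) +
          (t * (p + 1)) * (norm x powr \<alpha> * (phi (norm x) powr p * P (norm x))))"
        using weight_polar(1)[OF cE] intJ(1) by (simp add: set_integral_add E_def mass_u J_def)
      also have "\<dots> \<le> mass v"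
        unfolding mass_def
      proof (rule set_integral_mono)
        show "set_integrable lborel ?B (\<lambda>x. norm x powr \<alpha> * phi (norm x) powr (p + 1) +
          (t * (p + 1)) * (norm x powr \<alpha> * (phi (norm x) powr p * P (norm x))))"
          by (intro set_integral_add set_integrable_mult_right weight_polar(1)[OF cE] intJ(1))
        have "continuous_on {0..1} (\<lambda>r. \<bar>phi r + t * P r\<bar> powr (p + 1))"
          using p by (intro continuous_on_powr' continuous_intros phi_cont Pc) auto
        from weight_polar(1)[OF this]
        show "set_integrable lborel ?B (\<lambda>x. norm x powr \<alpha> * \<bar>v x\<bar> powr (p + 1))"
          by (simp add: v_def u_eq)
        show "norm x powr \<alpha> * phi (norm x) powr (p + 1) +
          (t * (p + 1)) * (norm x powr \<alpha> * (phi (norm x) powr p * P (norm x)))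
            \<le> norm x powr \<alpha> * \<bar>v x\<bar> powr (p + 1)" if "x \<in> ?B" for x
        proof -
          have "phi (norm x) powr (p + 1) + (p + 1) * phi (norm x) powr p * (v x - phi (norm x))
              \<le> \<bar>v x\<bar> powr (p + 1)"
            using that p by (intro powr_tangent_le phi_pos) auto
          then have "norm x powr \<alpha> * (phi (norm x) powr (p + 1) + (p + 1) * phi (norm x) powr p * (v x - phi (norm x)))
              \<le> norm x powr \<alpha> * \<bar>v x\<bar> powr (p + 1)"
            by (rule mult_left_mono) simp
          then show ?thesis by (simp add: v_def u_eq algebra_simps)
        qed
      qed
      finally show ?thesis .
    qed
    have "E * (mass v / E) powr (2 / (p + 1)) \<le> dirichlet v"
      unfolding E_def
    proof (rule rayleigh_quotient_le)
      show "radial v" by (simp add: radial_def v_def u_eq)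
      have "continuous_on (cball 0 1) (\<lambda>x::real^2. P (norm x))"
        by (rule continuous_on_compose2[OF Pc]) (auto intro!: continuous_intros)
      moreover have "continuous_on (cball 0 1) u" using nehari by (simp add: radial_nehari_def)
      ultimately show "continuous_on (cball 0 1) v"
        unfolding v_def by (intro continuous_intros)
      show "v differentiable_on ball 0 1"
        by (intro differentiable_at_imp_differentiable_on) (use v_der in \<open>auto simp: differentiable_def\<close>)
      have "continuous_on ?B (grad u)" using nehari by (simp add: radial_nehari_def)
      then have "continuous_on ?B (\<lambda>x. grad u x + t *\<^sub>R (G (norm x) *\<^sub>R sgn x))"
        by (intro continuous_on_add continuous_on_scaleR[OF continuous_on_const] continuous_on_radial_field[OF G])
      then show "continuous_on ?B (grad v)"
        by (rule continuous_on_eq) (simp add: grad_u grad_v algebra_simps)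
      show "v x = 0" if "norm x = 1" for x using that P(2) phi_1 by (simp add: v_def u_eq)
      show "0 < dirichlet v" using D D_v by simp
      show "0 < mass v" using N N_v by simp
    qed (fact int_v)
    moreover have "E * ((E + t * ((p + 1) * J)) / E) powr (2 / (p + 1)) \<le> E * (mass v / E) powr (2 / (p + 1))"
      using N N_v E0 p by (intro mult_left_mono powr_mono2 divide_right_mono) auto
    ultimately show ?thesis by (simp add: D_v)
  qed
  \<comment> \<open>\<open>F\<close> vanishes at 0 and is nonnegative nearby, so its derivative
    there, \<open>2 * I - 2 * J\<close>, is zero.\<close>
  define F where "F t = E + 2 * t * I + t^2 * K - E * ((E + t * ((p + 1) * J)) / E) powr (2 / (p + 1))" for t
  have "((\<lambda>t. E + 2 * t * I + t^2 * K) \<longlongrightarrow> E + 2 * 0 * I + 0^2 * K) (nhds 0)"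
    by (intro tendsto_intros filterlim_ident)
  then have ev1: "\<forall>\<^sub>F t in nhds 0. 0 < E + 2 * t * I + t^2 * K"
    using E0 by (intro order_tendstoD(1)) auto
  have "((\<lambda>t. E + t * ((p + 1) * J)) \<longlongrightarrow> E + 0 * ((p + 1) * J)) (nhds 0)"
    by (intro tendsto_intros filterlim_ident)
  then have ev2: "\<forall>\<^sub>F t in nhds 0. 0 < E + t * ((p + 1) * J)"
    using E0 by (intro order_tendstoD(1)) auto
  have F0: "F 0 = 0" using E0 by (simp add: F_def)
  have "\<forall>\<^sub>F t in nhds 0. F 0 \<le> F t"
    using ev1 ev2 unfolding F0 by eventually_elim (use key in \<open>simp add: F_def\<close>)
  then obtain d where d: "0 < d" "\<And>t. dist t 0 < d \<Longrightarrow> F 0 \<le> F t"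
    unfolding eventually_nhds_metric by blast
  have "(F has_real_derivative 2 * I - E * ((2 / (p + 1)) * ((p + 1) * J / E))) (at 0)"
    unfolding F_def using E0 by (auto intro!: derivative_eq_intros)
  then have "2 * I - E * ((2 / (p + 1)) * ((p + 1) * J / E)) = 0"
    by (rule DERIV_local_min[OF _ d(1)]) (use d(2) in \<open>auto simp: dist_real_def\<close>)
  moreover have "E * ((2 / (p + 1)) * ((p + 1) * J / E)) = 2 * J" using E0 p by simp
  ultimately have "I = J" by simp
  then show ?thesis unfolding I_def J_def intI(2) intJ(2) by simp
qed

section \<open>The once-integrated radial equation\<close>

definition flux :: "real \<Rightarrow> real" where
  "flux r = integral {0..r} (\<lambda>s. s powr (1 + \<alpha>) * phi s powr p)"

lemma flux_integrand_cont: "continuous_on {0..1} (\<lambda>s. s powr (1 + \<alpha>) * phi s powr p)"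
  using p by (intro continuous_on_mult weight'_cont phi_powr_cont) auto

lemma flux_has_derivative:
  assumes "r \<in> {0..1}"
  shows "(flux has_real_derivative r powr (1 + \<alpha>) * phi r powr p) (at r within {0..1})"
  unfolding flux_def by (rule integral_has_real_derivative[OF flux_integrand_cont assms])

lemma flux_cont: "continuous_on {0..1} flux"
  by (rule DERIV_continuous_on) (rule flux_has_derivative)

lemma flux_0: "flux 0 = 0"
  by (simp add: flux_def)

text \<open>\<open>u\<close> is only known to be continuously differentiable, so the equation is
  obtained in integrated form: testing the Euler-Lagrange identity with a function built from the
  defect \<open>r * phi' r + flux r\<close> shows that the defect vanishes.\<close>

lemma radial_ode:
  assumes r: "0 \<le> r" "r < 1"
  shows "r * phi' r = - flux r"
proof -
  \<comment> \<open>With the cutoff radius strictly between \<open>r\<close> and 1, the weight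
    \<open>b - s\<close> is positive at \<open>r\<close> and the test function stops before the
    boundary, where \<open>phi'\<close> is not controlled.\<close>
  define b where "b = (1 + r) / 2"
  have b: "r < b" "0 < b" "b < 1" using r by (auto simp: b_def)
  \<comment> \<open>Freezing the argument outside \<open>{0..b}\<close> makes \<open>G\<close>
    continuous on the whole line and zero from \<open>b\<close> on.\<close>
  define c where "c s = max 0 (min s b)" for s
  have c: "c s \<in> {0..b}" for s using b by (auto simp: c_def)
  \<comment> \<open>The test function has derivative \<open>(s \<phi>' + flux) (b - s)\<^sub>+\<close>, which makes the tested identity a
    weighted integral of a square.\<close>
  define G where "G s = (c s * phi' (c s) + flux (c s)) * (b - c s)" for s
  \<comment> \<open>Starting the integral at -1 gives \<open>P\<close> a two-sided derivative at 0;
    the subtracted constant gives \<open>P 1 = 0\<close>.\<close>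
  define P where "P s = integral {-1..s} G - integral {-1..1} G" for s
  have phi'_cont_b: "continuous_on {0..b} phi'"
    by (rule continuous_on_subset[OF phi'_cont]) (use b in auto)
  have flux_cont_b: "continuous_on {0..b} flux"
    by (rule continuous_on_subset[OF flux_cont]) (use b in auto)
  have c_cont: "continuous_on UNIV c" unfolding c_def by (intro continuous_intros)
  have "continuous_on UNIV (\<lambda>s. phi' (c s))"
    by (rule continuous_on_compose2[OF phi'_cont_b c_cont]) (use c in auto)
  moreover have "continuous_on UNIV (\<lambda>s. flux (c s))"
    by (rule continuous_on_compose2[OF flux_cont_b c_cont]) (use c in auto)
  ultimately have G_cont: "continuous_on UNIV G"
    unfolding G_def by (intro continuous_intros c_cont)
  have G0: "G 0 = 0" using b by (simp add: G_def c_def flux_0)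
  have G1: "G s = (s * phi' s + flux s) * (b - s)" if "0 \<le> s" "s \<le> b" for s
    using that by (simp add: G_def c_def)
  have G2: "G s = 0" if "b \<le> s" for s
    using that b by (simp add: G_def c_def)
  have P_der: "(P has_real_derivative G s) (at s)" if "s \<in> {0..1}" for s
  proof -
    have "((\<lambda>x. integral {-1..x} G) has_real_derivative G s) (at s within {-1..2})"
      using that by (intro integral_has_real_derivative continuous_on_subset[OF G_cont]) auto
    then have "((\<lambda>x. integral {-1..x} G) has_real_derivative G s) (at s)"
      using that by (subst (asm) at_within_interior) auto
    then show ?thesis unfolding P_def by (auto intro!: derivative_eq_intros)
  qed
  have P1: "P 1 = 0" by (simp add: P_def)
  have G_cont1: "continuous_on S G" for S by (rule continuous_on_subset[OF G_cont]) simp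
  have "continuous_on ({0..b} \<union> {b..1}) (\<lambda>s. phi' s * G s)"
  proof (rule continuous_on_closed_Un)
    show "continuous_on {0..b} (\<lambda>s. phi' s * G s)"
      by (intro continuous_on_mult phi'_cont_b G_cont1)
    show "continuous_on {b..1} (\<lambda>s. phi' s * G s)"
      by (rule continuous_on_eq[of _ "\<lambda>_. 0"]) (auto simp: G2)
  qed auto
  moreover have "{0..b} \<union> {b..1} = {0..1}" using b by auto
  ultimately have pG: "continuous_on {0..1} (\<lambda>s. phi' s * G s)" by simp
  have EL: "integral {0..1} (\<lambda>r. r * (phi' r * G r)) =
      integral {0..1} (\<lambda>r. r powr (1 + \<alpha>) * (phi r powr p * P r))"
    by (rule euler_lagrange[OF G_cont1 G0 P_der P1 pG])
  \<comment> \<open>Integration by parts; the boundary terms vanish because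
    \<open>flux 0 = 0\<close> and \<open>P 1 = 0\<close>.\<close>
  have "((\<lambda>s. s powr (1 + \<alpha>) * (phi s powr p * P s) + flux s * G s) has_integral (flux 1 * P 1 - flux 0 * P 0)) {0..1}"
  proof (rule fundamental_theorem_of_calculus)
    fix s :: real assume s: "s \<in> {0..1}"
    have "((\<lambda>s. flux s * P s) has_real_derivative
        (s powr (1 + \<alpha>) * phi s powr p * P s + G s * flux s)) (at s within {0..1})"
      by (intro DERIV_mult flux_has_derivative s has_field_derivative_at_within[OF P_der])
    then show "((\<lambda>s. flux s * P s) has_vector_derivative
        (s powr (1 + \<alpha>) * (phi s powr p * P s) + flux s * G s)) (at s within {0..1})"
      by (simp add: has_real_derivative_iff_has_vector_derivative mult_ac)
  qed simp
  then have ibp: "((\<lambda>s. s powr (1 + \<alpha>) * (phi s powr p * P s) + flux s * G s) has_integral 0) {0..1}"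
    by (simp add: P1 flux_0)
  have P_cont: "continuous_on {0..1} P"
    using P_der by (meson DERIV_isCont continuous_at_imp_continuous_on)
  have i1: "(\<lambda>s. s powr (1 + \<alpha>) * (phi s powr p * P s)) integrable_on {0..1}"
    using p by (intro integrable_continuous_interval continuous_on_mult weight'_cont phi_powr_cont P_cont) auto
  have i2: "(\<lambda>s. s * (phi' s * G s)) integrable_on {0..1}"
    by (intro integrable_continuous_interval continuous_on_mult pG continuous_on_id)
  \<comment> \<open>The Euler-Lagrange identity cancels the nonlinear term and leaves the integral
    of \<open>(s * phi' s + flux s) * G s\<close>, which up to \<open>b\<close> is a square times
    \<open>b - s\<close>.\<close>
  have "((\<lambda>s. (s powr (1 + \<alpha>) * (phi s powr p * P s) + flux s * G s)
      + (s * (phi' s * G s) - s powr (1 + \<alpha>) * (phi s powr p * P s))) has_integral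
      0 + (integral {0..1} (\<lambda>s. s * (phi' s * G s)) - integral {0..1} (\<lambda>s. s powr (1 + \<alpha>) * (phi s powr p * P s)))) {0..1}"
    by (intro has_integral_add ibp has_integral_diff integrable_integral i1 i2)
  then have z: "((\<lambda>s. flux s * G s + s * (phi' s * G s)) has_integral 0) {0..1}"
    by (simp add: EL)
  have c: "continuous_on {0..1} (\<lambda>s. flux s * G s + s * (phi' s * G s))"
    by (intro continuous_on_add continuous_on_mult flux_cont G_cont1 pG continuous_on_id)
  have nn: "0 \<le> flux s * G s + s * (phi' s * G s)" if "s \<in> {0..1}" for s
  proof (cases "s \<le> b")
    case True
    then have "flux s * G s + s * (phi' s * G s) = (s * phi' s + flux s)^2 * (b - s)"
      using that by (simp add: G1 power2_eq_square algebra_simps)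
    then show ?thesis using True by simp
  next
    case False
    then show ?thesis by (simp add: G2)
  qed
  have "integral {0..1} (\<lambda>s. flux s * G s + s * (phi' s * G s)) = 0"
    using z by (rule integral_unique)
  then have "\<forall>s\<in>{0..1}. flux s * G s + s * (phi' s * G s) = 0"
    by (subst (asm) integral_eq_0_iff[OF c]) (auto simp: nn)
  then have "flux r * G r + r * (phi' r * G r) = 0" by (rule bspec) (use r in auto)
  then have "(r * phi' r + flux r)^2 * (b - r) = 0"
    using r b by (simp add: G1 power2_eq_square algebra_simps)
  then show ?thesis using b by simp
qed

end

section \<open>The rescaled profile\<close>

text \<open>At the origin the difference quotient is \<open>y powr (a - 1)\<close>, which tends to 0
  as \<open>a > 1\<close>.\<close>

lemma powr_has_derivative_nonneg:
  fixes a R :: real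
  assumes "1 < a" "0 \<le> R"
  shows "((\<lambda>r. r powr a) has_real_derivative a * R powr (a - 1)) (at R within {0..})"
proof (cases "R = 0")
  case False
  then have "0 < R" using assms by simp
  then show ?thesis by (rule has_field_derivative_at_within[OF has_real_derivative_powr])
next
  case True
  have "continuous_on {0..} (\<lambda>y::real. y powr (a - 1))"
    using assms by (intro continuous_on_powr' continuous_intros) auto
  then have "((\<lambda>y. y powr (a - 1)) \<longlongrightarrow> 0 powr (a - 1)) (at 0 within {0..})"
    unfolding continuous_on_def by (rule bspec) simp
  moreover have "\<forall>\<^sub>F y in at 0 within {0..}. y powr (a - 1) = y powr a / y"
    by (auto simp: eventually_at_filter powr_diff)
  ultimately have "((\<lambda>y. y powr a / y) \<longlongrightarrow> 0) (at 0 within {0..})"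
    by (auto intro: Lim_transform_eventually)
  then show ?thesis using True by (simp add: has_field_derivative_iff)
qed

text \<open>The flux of the bubble read off here is
  \<open>R powr a / (a + R powr a / (2 * a))\<close>, the value at which the two bounds on
  \<open>m\<close> meet when \<open>c = 1\<close>.\<close>

lemma bubble_has_derivative:
  fixes a R :: real
  assumes "1 < a" "0 \<le> R"
  shows "((\<lambda>r. ln (4 * a^4 / (2 * a^2 + r powr a)^2)) has_real_derivative
    - (2 * a * R powr (a - 1) / (2 * a^2 + R powr a))) (at R within {0..})"
proof -
  have pos: "0 < 2 * a^2 + r powr a" for r using assms by (intro add_pos_nonneg) auto
  have eq: "ln (4 * a^4 / (2 * a^2 + r powr a)^2) = ln (4 * a^4) - 2 * ln (2 * a^2 + r powr a)" for r
    using assms pos[of r] by (simp add: ln_div ln_realpow)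
  have "((\<lambda>r. 2 * a^2 + r powr a) has_real_derivative 0 + a * R powr (a - 1)) (at R within {0..})"
    by (intro DERIV_add DERIV_const powr_has_derivative_nonneg assms)
  from DERIV_chain2[OF DERIV_ln_divide[OF pos] this]
  have "((\<lambda>r. ln (4 * a^4) - 2 * ln (2 * a^2 + r powr a)) has_real_derivative
      0 - 2 * (1 / (2 * a^2 + R powr a) * (0 + a * R powr (a - 1)))) (at R within {0..})"
    by (intro DERIV_diff DERIV_const DERIV_cmult)
  then show ?thesis unfolding eq by (simp add: mult.assoc)
qed

text \<open>The form in which the comparisons below are made: continuity up to the endpoints,
  derivatives only inside, where the differential system holds.\<close>

lemma mono_on_from_derivative:
  fixes f f' :: "real \<Rightarrow> real"
  assumes "a \<le> b" and "continuous_on {a..b} f"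
    and "\<And>x. a < x \<Longrightarrow> x < b \<Longrightarrow> (f has_real_derivative f' x) (at x)"
    and "\<And>x. a < x \<Longrightarrow> x < b \<Longrightarrow> 0 \<le> f' x"
  shows "f a \<le> f b"
  by (rule DERIV_nonneg_imp_increasing_open[OF assms(1)]) (use assms in blast)+

text \<open>The radial equation as a first-order system for \<open>f\<close> and its flux
  \<open>m\<close>; \<open>f L = - p\<close> says that the normalized solution vanishes at
  \<open>L\<close>, the image of the boundary.\<close>

locale scaled_profile =
  fixes a p L :: real and f m :: "real \<Rightarrow> real"
  assumes a: "2 \<le> a" and p: "1 < p" and L: "0 < L"
    and f_cont: "continuous_on {0..L} f" and m_cont: "continuous_on {0..<L} m"
    and f_0: "f 0 = 0" and f_L: "f L = - p" and m_0: "m 0 = 0"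
    and f_der: "\<And>R. 0 < R \<Longrightarrow> R < L \<Longrightarrow> (f has_real_derivative - m R / R) (at R)"
    and m_der: "\<And>R. 0 < R \<Longrightarrow> R < L \<Longrightarrow>
        (m has_real_derivative R powr (a - 1) * (1 + f R / p) powr p) (at R)"
    and w_pos: "\<And>R. 0 \<le> R \<Longrightarrow> R < L \<Longrightarrow> 0 < 1 + f R / p"
begin

definition w :: "real \<Rightarrow> real" where "w R = 1 + f R / p"
text \<open>This is \<open>R\<close> times the derivative of \<open>m\<close>, that is, the
  derivative of \<open>m\<close> in logarithmic time.\<close>

definition h :: "real \<Rightarrow> real" where "h R = R powr a * w R powr p"

lemma f_cont': "S \<subseteq> {0..L} \<Longrightarrow> continuous_on S f"
  by (rule continuous_on_subset[OF f_cont])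

lemma m_cont': "S \<subseteq> {0..<L} \<Longrightarrow> continuous_on S m"
  by (rule continuous_on_subset[OF m_cont])

lemma powr_cont: "S \<subseteq> {0..} \<Longrightarrow> continuous_on S (\<lambda>R. R powr a)"
  using a by (intro continuous_on_powr' continuous_intros) auto

lemma w_gt_0: "0 \<le> R \<Longrightarrow> R < L \<Longrightarrow> 0 < w R"
  using w_pos by (simp add: w_def)

lemma m_der': "0 < R \<Longrightarrow> R < L \<Longrightarrow> (m has_real_derivative R powr (a - 1) * w R powr p) (at R)"
  using m_der by (simp add: w_def)

lemma powr_der: "0 < R \<Longrightarrow> ((\<lambda>R. R powr a) has_real_derivative a * R powr (a - 1)) (at R)"
  by (rule has_real_derivative_powr)

section \<open>Monotonicity and elementary bounds\<close>

lemma m_mono: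
  assumes "0 \<le> x" "x \<le> y" "y < L"
  shows "m x \<le> m y"
  by (rule mono_on_from_derivative[OF assms(2) m_cont' m_der']) (use assms in auto)

lemma m_nonneg: "0 \<le> R \<Longrightarrow> R < L \<Longrightarrow> 0 \<le> m R"
  using m_mono[of 0 R] m_0 by simp

lemma m_pos:
  assumes "0 < R" "R < L"
  shows "0 < m R"
proof -
  have "m 0 < m R"
  proof (rule DERIV_pos_imp_increasing_open[OF assms(1)])
    fix x assume x: "0 < x" "x < R"
    then have "0 < x powr (a - 1) * w x powr p" using w_gt_0[of x] assms by auto
    then show "\<exists>y. (m has_real_derivative y) (at x) \<and> 0 < y"
      using m_der'[of x] x assms by auto
  qed (use assms in \<open>auto intro: m_cont'\<close>)
  then show ?thesis by (simp add: m_0)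
qed

lemma f_antimono:
  assumes "0 \<le> x" "x \<le> y" "y \<le> L"
  shows "f y \<le> f x"
proof -
  have "- f x \<le> - f y"
  proof (rule mono_on_from_derivative[OF assms(2)])
    fix z assume "x < z" "z < y"
    then show "((\<lambda>x. - f x) has_real_derivative m z / z) (at z)" "0 \<le> m z / z"
      using assms m_nonneg[of z] by (auto intro!: derivative_eq_intros f_der)
  qed (use assms in \<open>auto intro!: continuous_intros f_cont'\<close>)
  then show ?thesis by simp
qed

lemma w_antimono: "0 \<le> x \<Longrightarrow> x \<le> y \<Longrightarrow> y \<le> L \<Longrightarrow> w y \<le> w x"
  using f_antimono[of x y] p by (simp add: w_def divide_right_mono)

lemma w_le_1: "0 \<le> R \<Longrightarrow> R \<le> L \<Longrightarrow> w R \<le> 1"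
  using w_antimono[of 0 R] by (simp add: w_def f_0)

text \<open>Since \<open>w\<close> is at most 1, \<open>m\<close> grows no faster than it would with
  \<open>w\<close> replaced by 1.\<close>

lemma m_le_powr:
  assumes "0 \<le> R" "R < L"
  shows "m R \<le> R powr a / a"
proof -
  have "0 powr a / a - m 0 \<le> R powr a / a - m R"
  proof (rule mono_on_from_derivative[OF assms(1)])
    fix z assume z: "0 < z" "z < R"
    show "((\<lambda>R. R powr a / a - m R) has_real_derivative z powr (a - 1) - z powr (a - 1) * w z powr p) (at z)"
      using z assms a by (auto intro!: derivative_eq_intros powr_der m_der')
    have "w z powr p \<le> 1" using w_le_1[of z] w_gt_0[of z] z assms p by (intro powr_le1) auto
    then show "0 \<le> z powr (a - 1) - z powr (a - 1) * w z powr p"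
      using mult_left_mono[of "w z powr p" 1 "z powr (a - 1)"] by simp
  qed (use assms a in \<open>auto intro!: continuous_intros m_cont' powr_cont\<close>)
  then show ?thesis by (simp add: m_0)
qed

lemma f_ge_powr:
  assumes "0 \<le> R" "R \<le> L"
  shows "- (R powr a / a^2) \<le> f R"
proof -
  have "f 0 + 0 powr a / a^2 \<le> f R + R powr a / a^2"
  proof (rule mono_on_from_derivative[OF assms(1)])
    fix z assume z: "0 < z" "z < R"
    show "((\<lambda>R. f R + R powr a / a^2) has_real_derivative - m z / z + z powr (a - 1) / a) (at z)"
      using z assms a by (auto intro!: derivative_eq_intros powr_der f_der simp: power2_eq_square)
    have "m z / z \<le> z powr a / a / z" using z assms by (intro divide_right_mono m_le_powr) auto
    then show "0 \<le> - m z / z + z powr (a - 1) / a" using z by (simp add: powr_diff field_simps)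
  qed (use assms a in \<open>auto intro!: continuous_intros f_cont' powr_cont\<close>)
  then show ?thesis by (simp add: f_0)
qed

text \<open>\<open>f\<close> has to fall to \<open>- p\<close> at \<open>L\<close>, and
  \<open>f_ge_powr\<close> limits how fast it can fall. The interval therefore grows with
  \<open>p\<close> whatever the maximum of the solution is.\<close>

lemma L_powr_ge: "a^2 * p \<le> L powr a"
  using f_ge_powr[of L] L a by (simp add: f_L field_simps)

section \<open>Comparison estimates for the flux\<close>

lemma h_cont: "S \<subseteq> {0..<L} \<Longrightarrow> continuous_on S h"
  unfolding h_def[abs_def] w_def[abs_def]
proof (intro continuous_on_mult powr_cont)
  assume S: "S \<subseteq> {0..<L}"
  have "0 < 1 + f R / p" if "R \<in> S" for R using S that by (intro w_pos) auto
  then show "continuous_on S (\<lambda>R. (1 + f R / p) powr p)"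
    using S p by (intro continuous_on_powr continuous_intros f_cont') fastforce+
qed auto

text \<open>The exponent \<open>p\<close> cancels the \<open>1 / p\<close> inside \<open>w\<close>,
  so the derivative in logarithmic time is \<open>h * (a - m / w)\<close>.\<close>

lemma h_der:
  assumes "0 < R" "R < L"
  shows "(h has_real_derivative R powr (a - 1) * w R powr p * (a - m R / w R)) (at R)"
proof -
  have w: "0 < w R" using w_gt_0[of R] assms by simp
  have wd: "(w has_real_derivative - m R / R / p) (at R)"
    unfolding w_def[abs_def] using assms p by (auto intro!: derivative_eq_intros f_der)
  have "((\<lambda>R. w R powr p) has_real_derivative p * w R powr (p - 1) * (- m R / R / p)) (at R)"
    by (rule DERIV_chain2[OF has_real_derivative_powr[OF w] wd])
  then have "(h has_real_derivative
      (a * R powr (a - 1)) * w R powr p + (p * w R powr (p - 1) * (- m R / R / p)) * R powr a) (at R)"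
    unfolding h_def[abs_def] by (intro DERIV_mult powr_der assms)
  moreover have "(a * R powr (a - 1)) * w R powr p + (p * w R powr (p - 1) * (- m R / R / p)) * R powr a
      = R powr (a - 1) * w R powr p * (a - m R / w R)"
    using assms w p by (simp add: powr_diff field_simps)
  ultimately show ?thesis by simp
qed

text \<open>In logarithmic time the derivative of \<open>h\<close> is \<open>h (a - m / w)\<close> with \<open>0 < w \<le> 1\<close>, whereas the
  derivative of \<open>a m - m\<^sup>2 / 2\<close> is \<open>h (a - m)\<close>.  This Pohozaev-type comparison bounds \<open>m\<close> by its limiting
  total value \<open>2 a\<close>.\<close>

lemma h_le:
  assumes "0 \<le> R" "R < L"
  shows "h R \<le> a * m R - (m R)^2 / 2"
proof -
  have "a * m 0 - (m 0)^2 / 2 - h 0 \<le> a * m R - (m R)^2 / 2 - h R"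
  proof (rule mono_on_from_derivative[OF assms(1)])
    fix z assume z: "0 < z" "z < R"
    then have w: "0 < w z" "w z \<le> 1" "0 \<le> m z" using w_gt_0 w_le_1 m_nonneg assms by auto
    show "((\<lambda>R. a * m R - (m R)^2 / 2 - h R) has_real_derivative
        z powr (a - 1) * w z powr p * (m z / w z - m z)) (at z)"
      using z assms by (auto intro!: derivative_eq_intros m_der' h_der simp: algebra_simps)
    have "m z * 1 \<le> m z * (1 / w z)" using w by (intro mult_left_mono) auto
    then show "0 \<le> z powr (a - 1) * w z powr p * (m z / w z - m z)" by simp
  qed (use assms in \<open>auto intro!: continuous_intros m_cont' h_cont\<close>)
  then show ?thesis by (simp add: m_0 h_def)
qed

text \<open>The reverse of \<open>h_le\<close>: \<open>w\<close> decreases, so \<open>c\<close>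
  bounds \<open>1 / w\<close> on all of \<open>{0..R}\<close>.\<close>

lemma h_ge:
  assumes "0 \<le> R" "R < L" and c: "1 / w R \<le> c"
  shows "a * m R - c * (m R)^2 / 2 \<le> h R"
proof -
  have "h 0 - (a * m 0 - c * (m 0)^2 / 2) \<le> h R - (a * m R - c * (m R)^2 / 2)"
  proof (rule mono_on_from_derivative[OF assms(1)])
    fix z assume z: "0 < z" "z < R"
    then have w: "0 < w R" "w R \<le> w z" "0 \<le> m z" using w_gt_0 w_antimono m_nonneg assms by auto
    show "((\<lambda>R. h R - (a * m R - c * (m R)^2 / 2)) has_real_derivative
        z powr (a - 1) * w z powr p * (c * m z - m z / w z)) (at z)"
      using z assms by (auto intro!: derivative_eq_intros m_der' h_der simp: algebra_simps)
    have "1 / w z \<le> 1 / w R" using w by (intro divide_left_mono mult_pos_pos) auto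
    then have "m z * (1 / w z) \<le> m z * c" using w c by (intro mult_left_mono) auto
    then show "0 \<le> z powr (a - 1) * w z powr p * (c * m z - m z / w z)" by (simp add: mult.commute)
  qed (use assms in \<open>auto intro!: continuous_intros m_cont' h_cont\<close>)
  then show ?thesis by (simp add: m_0 h_def)
qed

text \<open>\<open>h\<close> is nonnegative, and \<open>h_le\<close> bounds it by
  \<open>m R * (a - m R / 2)\<close>.\<close>

lemma m_le_2a:
  assumes "0 < R" "R < L"
  shows "m R \<le> 2 * a"
proof -
  have "0 \<le> h R" by (simp add: h_def)
  then have "0 \<le> m R * (a - m R / 2)" using h_le[of R] assms by (simp add: power2_eq_square algebra_simps)
  then show ?thesis using m_pos[OF assms] by (simp add: zero_le_mult_iff)
qed

text \<open>For the bubble \<open>h = a * m - m^2 / 2\<close>, which makes this reciprocal quantity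
  exactly \<open>a + R powr a / (2 * a)\<close>; bounds on \<open>h\<close> thus integrate to bounds
  affine in \<open>R powr a\<close>.\<close>

definition q :: "real \<Rightarrow> real" where "q R = R powr a / m R"

lemma q_der:
  assumes "0 < R" "R < L"
  shows "(q has_real_derivative R powr (a - 1) * ((a * m R - h R) / (m R)^2)) (at R)"
proof -
  have "(q has_real_derivative
      (a * R powr (a - 1) * m R - R powr a * (R powr (a - 1) * w R powr p)) / (m R * m R)) (at R)"
    unfolding q_def[abs_def] using m_pos[OF assms] assms by (intro DERIV_divide powr_der m_der') auto
  moreover have "R powr a * (R powr (a - 1) * w R powr p) = R powr (a - 1) * h R"
    by (simp add: h_def)
  ultimately show ?thesis by (simp add: power2_eq_square algebra_simps)
qed

lemma q_cont:
  assumes "S \<subseteq> {0<..<L}"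
  shows "continuous_on S q"
proof (intro continuous_at_imp_continuous_on ballI)
  fix x assume "x \<in> S"
  with assms have "0 < x" "x < L" by auto
  then show "isCont q x" by (rule DERIV_isCont[OF q_der])
qed

lemma q_ge_a: "0 < R \<Longrightarrow> R < L \<Longrightarrow> a \<le> q R"
  using m_le_powr[of R] m_pos[of R] a by (simp add: q_def field_simps)

lemma q_ge:
  assumes "0 < R" "R < L"
  shows "a + R powr a / (2 * a) \<le> q R"
proof -
  \<comment> \<open>Integration starts at \<open>e > 0\<close>: at 0 the quotient is
    \<open>0 / 0\<close>, with default value 0 instead of the limit \<open>a\<close>. Afterwards
    \<open>e\<close> tends to 0.\<close>
  have ineq: "a - e powr a / (2 * a) \<le> q R - R powr a / (2 * a)" if e: "0 < e" "e < R" for e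
  proof -
    have "q e - e powr a / (2 * a) \<le> q R - R powr a / (2 * a)"
    proof (rule mono_on_from_derivative[of e R])
      fix z assume z: "e < z" "z < R"
      then have m: "0 < m z" using m_pos e assms by auto
      show "((\<lambda>R. q R - R powr a / (2 * a)) has_real_derivative
          z powr (a - 1) * ((a * m z - h z) / (m z)^2) - z powr (a - 1) * (1 / 2)) (at z)"
        using z e assms a by (auto intro!: derivative_eq_intros powr_der q_der)
      have "(m z)^2 / 2 \<le> a * m z - h z" using h_le[of z] z e assms by simp
      then have "1 / 2 \<le> (a * m z - h z) / (m z)^2" using m by (simp add: field_simps)
      then have "z powr (a - 1) * (1 / 2) \<le> z powr (a - 1) * ((a * m z - h z) / (m z)^2)"
        by (rule mult_left_mono) simp
      then show "0 \<le> z powr (a - 1) * ((a * m z - h z) / (m z)^2) - z powr (a - 1) * (1 / 2)" by simp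
    qed (use e assms a in \<open>auto intro!: continuous_intros q_cont powr_cont\<close>)
    then show ?thesis using q_ge_a[of e] e assms by simp
  qed
  have "((\<lambda>e. a - e powr a / (2 * a)) \<longlongrightarrow> a - 0 powr a / (2 * a)) (at_right 0)"
    using a by (intro tendsto_intros tendsto_powr') (auto simp: eventually_at_filter)
  moreover have "\<forall>\<^sub>F e in at_right 0. a - e powr a / (2 * a) \<le> q R - R powr a / (2 * a)"
    using assms ineq by (auto simp: eventually_at_right_field)
  ultimately have "a - 0 powr a / (2 * a) \<le> q R - R powr a / (2 * a)"
    by (intro tendsto_upperbound) auto
  then show ?thesis by simp
qed

text \<open>On \<open>{0..e}\<close> the derivative of \<open>m\<close> is at least the one with
  \<open>w\<close> frozen at \<open>w e\<close>. The bound tends to \<open>a\<close> as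
  \<open>e\<close> tends to 0, which supplies the initial value for \<open>q_le\<close>.\<close>

lemma q_le_near_0:
  assumes "0 < e" "e < L"
  shows "q e \<le> a / w e powr p"
proof -
  have w: "0 < w e" using w_gt_0[of e] assms by auto
  have "m 0 - w e powr p * (0 powr a / a) \<le> m e - w e powr p * (e powr a / a)"
  proof (rule mono_on_from_derivative[of 0 e])
    fix z assume z: "0 < z" "z < e"
    show "((\<lambda>R. m R - w e powr p * (R powr a / a)) has_real_derivative
        z powr (a - 1) * w z powr p - w e powr p * z powr (a - 1)) (at z)"
      using z assms a by (auto intro!: derivative_eq_intros m_der' powr_der)
    have "w e powr p \<le> w z powr p" using w w_antimono[of z e] z assms p by (intro powr_mono2) auto
    then show "0 \<le> z powr (a - 1) * w z powr p - w e powr p * z powr (a - 1)"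
      using mult_left_mono[of "w e powr p" "w z powr p" "z powr (a - 1)"] by (simp add: mult.commute)
  qed (use assms a in \<open>auto intro!: continuous_intros m_cont' powr_cont\<close>)
  then have "w e powr p * (e powr a / a) \<le> m e" by (simp add: m_0)
  then show ?thesis using m_pos[OF assms] w a by (simp add: q_def field_simps)
qed

text \<open>Counterpart of \<open>q_ge\<close>: by \<open>h_ge\<close> the derivative of
  \<open>q\<close> at \<open>z\<close> is at most \<open>z powr (a - 1) * (c / 2)\<close> up to
  \<open>R\<close>.\<close>

lemma q_le:
  assumes "0 < R" "R < L" and c: "1 / w R \<le> c"
  shows "q R \<le> a + c * R powr a / (2 * a)"
proof -
  have ineq: "q R - c * R powr a / (2 * a) \<le> a / w e powr p" if e: "0 < e" "e < R" for e
  proof -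
    have "c * e powr a / (2 * a) - q e \<le> c * R powr a / (2 * a) - q R"
    proof (rule mono_on_from_derivative[of e R])
      fix z assume z: "e < z" "z < R"
      then have m: "0 < m z" using m_pos e assms by auto
      show "((\<lambda>R. c * R powr a / (2 * a) - q R) has_real_derivative
          z powr (a - 1) * (c / 2) - z powr (a - 1) * ((a * m z - h z) / (m z)^2)) (at z)"
        using z e assms a by (auto intro!: derivative_eq_intros powr_der q_der)
      have "w R \<le> w z" "0 < w R" using w_antimono w_gt_0 z e assms by auto
      then have "1 / w z \<le> 1 / w R" by (intro divide_left_mono mult_pos_pos) auto
      then have "a * m z - h z \<le> c * (m z)^2 / 2" using h_ge[of z c] z e assms by simp
      then have "(a * m z - h z) / (m z)^2 \<le> c / 2" using m by (simp add: field_simps)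
      then have "z powr (a - 1) * ((a * m z - h z) / (m z)^2) \<le> z powr (a - 1) * (c / 2)"
        by (rule mult_left_mono) simp
      then show "0 \<le> z powr (a - 1) * (c / 2) - z powr (a - 1) * ((a * m z - h z) / (m z)^2)" by simp
    qed (use e assms a in \<open>auto intro!: continuous_intros q_cont powr_cont\<close>)
    \<comment> \<open>Nonnegativity of \<open>c\<close> allows the term in \<open>e powr a\<close>
      to be dropped.\<close>
    moreover have "0 \<le> c"
    proof -
      have "0 \<le> 1 / w R" using w_gt_0[of R] assms by simp
      then show ?thesis using c by linarith
    qed
    then have "0 \<le> c * e powr a / (2 * a)" using a by simp
    ultimately show ?thesis using q_le_near_0[of e] e assms by linarith
  qed
  have "(f \<longlongrightarrow> f 0) (at 0 within {0..L})" using f_cont L by (auto simp: continuous_on_def)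
  then have "(f \<longlongrightarrow> 0) (at_right 0)"
    using L by (simp add: f_0 at_within_Icc_at_right)
  then have "((\<lambda>e. a / w e powr p) \<longlongrightarrow> a / (1 + 0 / p) powr p) (at_right 0)"
    unfolding w_def using p by (intro tendsto_intros) auto
  moreover have "\<forall>\<^sub>F e in at_right 0. q R - c * R powr a / (2 * a) \<le> a / w e powr p"
    using assms ineq by (auto simp: eventually_at_right_field)
  ultimately have "q R - c * R powr a / (2 * a) \<le> a / (1 + 0 / p) powr p"
    by (intro tendsto_lowerbound) auto
  then show ?thesis by simp
qed

text \<open>An explicit admissible \<open>c\<close> for \<open>h_ge\<close> and \<open>q_le\<close>;
  for fixed \<open>R\<close> it tends to 1 as \<open>p\<close> grows.\<close>

lemma inverse_w_le:
  assumes "0 \<le> R" "R < L" and R: "R powr a < a^2 * p"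
  shows "1 / w R \<le> 1 / (1 - R powr a / (a^2 * p))"
proof -
  have ap: "0 < a^2 * p" using a p by simp
  have "- (R powr a / a^2) / p \<le> f R / p" using f_ge_powr[of R] assms p by (intro divide_right_mono) auto
  then have "1 - R powr a / (a^2 * p) \<le> w R" by (simp add: w_def)
  moreover have "0 < 1 - R powr a / (a^2 * p)" using R ap by (simp add: field_simps)
  ultimately show ?thesis by (intro divide_left_mono mult_pos_pos) auto
qed

section \<open>Logarithmic size of the interval\<close>

lemma p_le_ln:
  assumes "1 \<le> L"
  shows "p \<le> 1 / a^2 + 2 * a * ln L"
proof -
  \<comment> \<open>On \<open>{1..L}\<close> the slope of \<open>f\<close> is at least
    \<open>- 2 * a / R\<close> by \<open>m_le_2a\<close>; the drop up to radius 1 costs at most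
    \<open>1 / a^2\<close>.\<close>
  have "f 1 + 2 * a * ln 1 \<le> f L + 2 * a * ln L"
  proof (rule mono_on_from_derivative[OF assms])
    fix z assume z: "1 < z" "z < L"
    show "((\<lambda>R. f R + 2 * a * ln R) has_real_derivative - m z / z + 2 * a / z) (at z)"
      using z by (auto intro!: derivative_eq_intros f_der)
    show "0 \<le> - m z / z + 2 * a / z" using m_le_2a[of z] z by (simp add: field_simps)
  qed (use assms in \<open>auto intro!: continuous_intros f_cont'\<close>)
  then show ?thesis using f_ge_powr[of 1] assms by (simp add: f_L)
qed

text \<open>Beyond \<open>A\<close> the flux is at least \<open>m A\<close>, so \<open>f\<close>
  falls at least logarithmically with this coefficient.\<close>

lemma p_ge_ln:
  assumes "0 < A" "A < L"
  shows "m A * (ln L - ln A) \<le> p"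
proof -
  have "- f A - m A * ln A \<le> - f L - m A * ln L"
  proof (rule mono_on_from_derivative[of A L])
    fix z assume z: "A < z" "z < L"
    show "((\<lambda>R. - f R - m A * ln R) has_real_derivative m z / z - m A / z) (at z)"
      using z assms by (auto intro!: derivative_eq_intros f_der)
    show "0 \<le> m z / z - m A / z" using m_mono[of A z] z assms by (simp add: field_simps)
  qed (use assms in \<open>auto intro!: continuous_intros f_cont'\<close>)
  then show ?thesis using f_antimono[of 0 A] assms by (simp add: f_L f_0 algebra_simps)
qed

text \<open>\<open>p_ge_ln\<close> at a radius \<open>A\<close> where the upper bound on
  \<open>q\<close> bounds \<open>1 / m A\<close> by nearly \<open>1 / (2 * a)\<close>; the last
  summand is \<open>ln A\<close>.\<close>

lemma ln_L_le:
  "ln L \<le> p * (a / sqrt p + 1 / (1 - 1 / (a^2 * sqrt p)) / (2 * a)) + ln p / (2 * a)"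
proof -
  \<comment> \<open>The radius with \<open>A\<^bsup>a\<^esup> = \<surd>p\<close> tends to infinity, yet slowly enough for \<open>1 / w\<close> to tend to \<open>1\<close> on \<open>[0, A]\<close>.\<close>
  define A where "A = p powr (1 / (2 * a))"
  define c where "c = 1 / (1 - 1 / (a^2 * sqrt p))"
  have A: "0 < A" using p by (simp add: A_def)
  have Aa: "A powr a = sqrt p" using a p by (simp add: A_def powr_powr powr_half_sqrt)
  have a4: "4 \<le> a^2" using power_mono[of 2 a 2] a by simp
  have "1 < sqrt p" using p by simp
  moreover have "sqrt p * sqrt p = p" using p by simp
  ultimately have sp: "1 < sqrt p" "sqrt p < p" using mult_strict_right_mono[of 1 "sqrt p" "sqrt p"] by auto
  have "1 * p \<le> a^2 * p" using a4 p by (intro mult_right_mono) auto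
  then have lt: "A powr a < a^2 * p" using Aa sp by linarith
  then have "A powr a < L powr a" using L_powr_ge by linarith
  then have AL: "A < L" using L a powr_mono2[of a L A] by (cases "A < L") auto
  have "A powr a / (a^2 * p) = 1 / (a^2 * sqrt p)"
    using Aa p \<open>sqrt p * sqrt p = p\<close> a by (simp add: field_simps)
  then have "1 / w A \<le> c" using inverse_w_le[of A] lt A AL by (simp add: c_def)
  then have "q A \<le> a + c * sqrt p / (2 * a)" using q_le[of A c] A AL by (simp add: Aa)
  then have "p * (q A / sqrt p) \<le> p * ((a + c * sqrt p / (2 * a)) / sqrt p)"
    using p by (intro mult_left_mono divide_right_mono) auto
  also have "(a + c * sqrt p / (2 * a)) / sqrt p = a / sqrt p + c / (2 * a)"
    using sp by (simp add: add_divide_distrib)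
  finally have 1: "p * (q A / sqrt p) \<le> p * (a / sqrt p + c / (2 * a))" .
  have mA: "0 < m A" using m_pos A AL by simp
  have "ln L - ln A \<le> p / m A" using p_ge_ln[OF A AL] mA by (simp add: field_simps)
  also have "p / m A = p * (q A / sqrt p)" using sp by (simp add: q_def Aa)
  also note 1
  finally have "ln L - ln A \<le> p * (a / sqrt p + c / (2 * a))" .
  moreover have "ln A = ln p / (2 * a)" using p by (simp add: A_def ln_powr)
  ultimately show ?thesis by (simp add: c_def)
qed

section \<open>Distance to the bubble\<close>

lemma derivative_error:
  assumes R: "0 < R" "R \<le> A" "A < L" and A: "A powr a < a^2 * p"
  shows "\<bar>- m R / R - - (2 * a * R powr (a - 1) / (2 * a^2 + R powr a))\<bar>
    \<le> (1 / (1 - A powr a / (a^2 * p)) - 1) * A powr (2 * a - 1) / (2 * a^3)"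
proof -
  define c where "c = 1 / (1 - A powr a / (a^2 * p))"
  define x where "x = R powr a"
  have x: "0 < x" "x \<le> A powr a" using R a by (auto simp: x_def intro: powr_mono2)
  have RL: "R < L" using R by simp
  have "1 / w A \<le> c" unfolding c_def using inverse_w_le[of A] R A by simp
  moreover have "1 / w R \<le> 1 / w A" using w_antimono[of R A] w_gt_0[of A] R
    by (intro divide_left_mono mult_pos_pos) auto
  ultimately have cR: "1 / w R \<le> c" by simp
  have "1 \<le> 1 / w R" using w_le_1[of R] w_gt_0[of R] R RL by simp
  then have c1: "1 \<le> c" using cR by simp
  have m: "0 < m R" using m_pos R RL by simp
  have mq: "m R = x / q R" using x m by (simp add: q_def x_def)
  have q1: "a + x / (2 * a) \<le> q R" using q_ge[of R] R RL by (simp add: x_def)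
  have q2: "q R \<le> a + c * x / (2 * a)" using q_le[of R c] R RL cR by (simp add: x_def)
  have q0: "0 < a + x / (2 * a)" using a x by (intro add_pos_pos) auto
  \<comment> \<open>The slope of the bubble belongs to a flux whose \<open>q\<close> equals the
    lower bound of \<open>q_ge\<close>, so its difference from \<open>m\<close> has a sign.\<close>
  have eq: "2 * a * R powr (a - 1) / (2 * a^2 + R powr a) = x / (a + x / (2 * a)) / R"
  proof -
    have "a + x / (2 * a) = (2 * a^2 + x) / (2 * a)" using a by (simp add: field_simps power2_eq_square)
    then show ?thesis using R by (simp add: x_def powr_diff mult_ac)
  qed
  have qpos: "0 < q R" using q0 q1 by linarith
  have up: "m R \<le> x / (a + x / (2 * a))"
    unfolding mq using q1 q0 x qpos by (intro divide_left_mono mult_pos_pos) auto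
  have "x / (a + x / (2 * a)) - m R = x * (q R - (a + x / (2 * a))) / ((a + x / (2 * a)) * q R)"
    unfolding mq using q0 qpos by (simp add: diff_divide_distrib diff_frac_eq algebra_simps)
  \<comment> \<open>The numerator is estimated by the upper bound on \<open>q\<close>, and both
    factors of the denominator are at least \<open>a\<close>.\<close>
  also have "\<dots> \<le> x * ((c - 1) * x / (2 * a)) / (a * a)"
  proof (rule frac_le)
    show "x * (q R - (a + x / (2 * a))) \<le> x * ((c - 1) * x / (2 * a))"
      using q2 x by (intro mult_left_mono) (auto simp: diff_divide_distrib algebra_simps)
    show "a * a \<le> (a + x / (2 * a)) * q R"
      using q1 x a by (intro mult_mono) (auto intro: order_trans[OF _ q1])
    show "0 \<le> x * ((c - 1) * x / (2 * a))" using x c1 a by simp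
    show "0 < a * a" using a by simp
  qed
  also have "\<dots> = (c - 1) * (x * x) / (2 * a^3)" by (simp add: power3_eq_cube mult_ac)
  finally have lo: "x / (a + x / (2 * a)) - m R \<le> (c - 1) * (x * x) / (2 * a^3)" .
  have "\<bar>- m R / R - - (2 * a * R powr (a - 1) / (2 * a^2 + R powr a))\<bar> = (x / (a + x / (2 * a)) - m R) / R"
  proof -
    define X where "X = x / (a + x / (2 * a))"
    have "- m R / R - - (X / R) = (X - m R) / R" by (simp add: diff_divide_distrib)
    moreover have "0 \<le> (X - m R) / R" using up R by (simp add: X_def)
    ultimately show ?thesis unfolding eq X_def by (simp only: abs_of_nonneg)
  qed
  also have "\<dots> \<le> (c - 1) * (x * x) / (2 * a^3) / R" using lo R by (intro divide_right_mono) auto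
  \<comment> \<open>Division by the possibly small \<open>R\<close> is harmless:
    \<open>x * x / R\<close> is a positive power of \<open>R\<close>, hence at most its value at
    \<open>A\<close>.\<close>
  also have "\<dots> = (c - 1) * R powr (2 * a - 1) / (2 * a^3)"
  proof -
    have "x * x / R = R powr (2 * a - 1)" using R by (simp add: x_def powr_diff flip: powr_add)
    then have "(c - 1) / (2 * a^3) * (x * x / R) = (c - 1) / (2 * a^3) * R powr (2 * a - 1)" by simp
    then show ?thesis by (simp add: mult_ac)
  qed
  also have "\<dots> \<le> (c - 1) * A powr (2 * a - 1) / (2 * a^3)"
    using c1 R a by (intro divide_right_mono mult_left_mono powr_mono2) auto
  finally show ?thesis by (simp add: c_def)
qed

text \<open>Both functions vanish at 0 because \<open>4 * a^4 = (2 * a^2)^2\<close>, so the mean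
  value theorem turns \<open>derivative_error\<close> into this bound.\<close>

lemma value_error:
  assumes R: "0 \<le> R" "R \<le> A" "A < L" and A: "A powr a < a^2 * p"
  shows "\<bar>f R - ln (4 * a^4 / (2 * a^2 + R powr a)^2)\<bar>
    \<le> A * ((1 / (1 - A powr a / (a^2 * p)) - 1) * A powr (2 * a - 1) / (2 * a^3))" (is "_ \<le> A * ?e")
proof (cases "R = 0")
  case True
  have "(2 * a^2)^2 = 4 * a^4" by (simp add: power_mult_distrib flip: power_mult)
  moreover have "1 \<le> 1 / (1 - A powr a / (a^2 * p))"
    using A a p by (simp add: field_simps)
  ultimately show ?thesis using True R a by (simp add: f_0)
next
  case False
  define g where "g R = f R - ln (4 * a^4 / (2 * a^2 + R powr a)^2)" for R
  have pos: "0 < 2 * a^2 + r powr a" for r using a by (intro add_pos_nonneg) auto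
  have g_der: "(g has_real_derivative - m z / z - - (2 * a * z powr (a - 1) / (2 * a^2 + z powr a))) (at z)"
    if "0 < z" "z < L" for z
  proof -
    have "((\<lambda>r. ln (4 * a^4 / (2 * a^2 + r powr a)^2)) has_real_derivative
      - (2 * a * z powr (a - 1) / (2 * a^2 + z powr a))) (at z within {0..})"
      using bubble_has_derivative a that by simp
    then have "((\<lambda>r. ln (4 * a^4 / (2 * a^2 + r powr a)^2)) has_real_derivative
      - (2 * a * z powr (a - 1) / (2 * a^2 + z powr a))) (at z)"
      using that by (subst (asm) at_within_interior) auto
    then show ?thesis unfolding g_def[abs_def] by (intro DERIV_diff f_der that)
  qed
  have "continuous_on {0..R} g"
    unfolding g_def[abs_def] using pos R a
    by (intro continuous_intros f_cont' powr_cont) (auto simp: less_le)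
  moreover have "g differentiable (at x)" if "0 < x" "x < R" for x
    using g_der[of x] that R unfolding real_differentiable_def by auto
  ultimately obtain l z where z: "0 < z" "z < R" "(g has_real_derivative l) (at z)" "g R - g 0 = (R - 0) * l"
    using MVT[of 0 R g] False R by auto
  have l: "l = - m z / z - - (2 * a * z powr (a - 1) / (2 * a^2 + z powr a))"
    using DERIV_unique[OF z(3) g_der] z R by simp
  have "(2 * a^2)^2 = 4 * a^4" by (simp add: power_mult_distrib flip: power_mult)
  then have "g 0 = 0" using a by (simp add: g_def f_0)
  then have "\<bar>g R\<bar> = R * \<bar>- m z / z - - (2 * a * z powr (a - 1) / (2 * a^2 + z powr a))\<bar>"
    using z(4) R by (simp add: abs_mult l)
  also have "\<dots> \<le> A * ?e"
    using z R A by (intro mult_mono derivative_error) auto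
  finally show ?thesis by (simp add: g_def)
qed

end

section \<open>Asymptotics\<close>

text \<open>The bound of \<open>derivative_error\<close>: the excess over 1 of the constant from
  \<open>inverse_w_le\<close>, times a factor free of \<open>p\<close>.\<close>

definition bubble_error :: "real \<Rightarrow> real \<Rightarrow> real \<Rightarrow> real" where
  "bubble_error a A p = (1 / (1 - A powr a / (a^2 * p)) - 1) * A powr (2 * a - 1) / (2 * a^3)"

lemma bubble_error_tendsto_0: "((\<lambda>p. bubble_error a A p) \<longlongrightarrow> 0) at_top"
proof (cases "a = 0")
  case False
  have "((\<lambda>p. A powr a / a^2 / p) \<longlongrightarrow> 0) at_top"
    by (intro tendsto_divide_0[OF tendsto_const] filterlim_at_top_imp_at_infinity filterlim_ident)
  then have "((\<lambda>p. A powr a / (a^2 * p)) \<longlongrightarrow> 0) at_top" by simp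
  then have "((\<lambda>p. (1 / (1 - A powr a / (a^2 * p)) - 1) * A powr (2 * a - 1) / (2 * a^3)) \<longlongrightarrow>
      (1 / (1 - 0) - 1) * A powr (2 * a - 1) / (2 * a^3)) at_top"
    using False by (intro tendsto_intros) auto
  then show ?thesis by (simp add: bubble_error_def)
qed (simp add: bubble_error_def)

context positive_least_energy
begin

section \<open>The rescaled solution as a scaled profile\<close>

definition mu :: real where "mu = u 0"
definition rho :: real where "rho = (p * mu powr (p - 1)) powr (- 1 / (2 + \<alpha>))"
definition profile_f :: "real \<Rightarrow> real" where "profile_f R = p * (phi (rho * R) - mu) / mu"
definition profile_m :: "real \<Rightarrow> real" where "profile_m R = p * flux (rho * R) / mu"

lemma mu_eq: "mu = phi 0"
  by (simp add: mu_def phi_def)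

lemma mu_pos: "0 < mu"
  using phi_pos[of 0] by (simp add: mu_eq)

lemma rho_pos: "0 < rho"
  using p mu_pos by (simp add: rho_def)

text \<open>The scale \<open>rho\<close> is chosen for this identity, which makes the coefficient of
  the rescaled nonlinearity equal to 1.\<close>

lemma rho_powr: "p * rho powr (2 + \<alpha>) * mu powr p = mu"
proof -
  have "- 1 / (2 + \<alpha>) * (2 + \<alpha>) = - 1" using alpha by simp
  then have "rho powr (2 + \<alpha>) = (p * mu powr (p - 1)) powr (- 1)" by (simp only: rho_def powr_powr)
  then have "rho powr (2 + \<alpha>) = 1 / (p * mu powr (p - 1))"
    using p mu_pos by (simp add: powr_minus_divide)
  then show ?thesis using p mu_pos by (simp add: powr_diff)
qed

text \<open>Scaling maps the unit radius to \<open>1 / rho\<close>. The first equation of the system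
  is \<open>radial_ode\<close>; the second is the derivative of \<open>flux\<close>, normalized by
  \<open>rho_powr\<close>.\<close>

sublocale profile: scaled_profile "2 + \<alpha>" p "1 / rho" profile_f profile_m
proof
  have sub: "rho * R \<in> {0..1}" if "R \<in> {0..1 / rho}" for R using that rho_pos by (auto simp: field_simps)
  have lt: "rho * R < 1" if "R < 1 / rho" for R using that rho_pos by (simp add: field_simps)
  show "continuous_on {0..1 / rho} profile_f"
    unfolding profile_f_def using mu_pos sub
    by (intro continuous_intros continuous_on_compose2[OF phi_cont]) auto
  have "continuous_on {0..1 / rho} profile_m"
    unfolding profile_m_def using mu_pos sub
    by (intro continuous_intros continuous_on_compose2[OF flux_cont]) auto
  then show "continuous_on {0..<1 / rho} profile_m" by (rule continuous_on_subset) auto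
  show "profile_f 0 = 0" by (simp add: profile_f_def mu_eq)
  show "profile_f (1 / rho) = - p" using rho_pos mu_pos by (simp add: profile_f_def phi_1)
  show "profile_m 0 = 0" by (simp add: profile_m_def flux_0)
  show "0 < 1 + profile_f R / p" if "0 \<le> R" "R < 1 / rho" for R
  proof -
    have "1 + profile_f R / p = phi (rho * R) / mu"
      using p mu_pos by (simp add: profile_f_def field_simps)
    then show ?thesis using phi_pos[of "rho * R"] that rho_pos mu_pos lt by simp
  qed
  fix R assume R: "0 < R" "R < 1 / rho"
  have r: "0 < rho * R" "rho * R < 1" using R lt rho_pos by auto
  have lin: "((\<lambda>R. rho * R) has_real_derivative rho) (at R)" by (auto intro!: derivative_eq_intros)
  have "((\<lambda>R. phi (rho * R)) has_real_derivative phi' (rho * R) * rho) (at R)"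
    by (rule DERIV_chain2[OF phi_has_derivative lin]) (use r in auto)
  then have "(profile_f has_real_derivative p * (phi' (rho * R) * rho - 0) / mu) (at R)"
    unfolding profile_f_def[abs_def] by (intro DERIV_cdivide DERIV_cmult DERIV_diff DERIV_const)
  moreover have "p * (phi' (rho * R) * rho - 0) / mu = - profile_m R / R"
  proof -
    have "flux (rho * R) = - (rho * R * phi' (rho * R))" using radial_ode[of "rho * R"] r by simp
    then show ?thesis using R by (simp add: profile_m_def)
  qed
  ultimately show "(profile_f has_real_derivative - profile_m R / R) (at R)" by simp
  have "(flux has_real_derivative (rho * R) powr (1 + \<alpha>) * phi (rho * R) powr p) (at (rho * R))"
    using r flux_has_derivative[of "rho * R"] at_within_interior[of "rho * R" "{0..1}"] by simp
  from DERIV_chain2[OF this lin]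
  have "(profile_m has_real_derivative p * ((rho * R) powr (1 + \<alpha>) * phi (rho * R) powr p * rho) / mu) (at R)"
    unfolding profile_m_def[abs_def] by (intro DERIV_cdivide DERIV_cmult)
  moreover have "p * ((rho * R) powr (1 + \<alpha>) * phi (rho * R) powr p * rho) / mu =
      R powr (2 + \<alpha> - 1) * (1 + profile_f R / p) powr p"
  proof -
    have e: "1 + profile_f R / p = phi (rho * R) / mu"
      using p mu_pos by (simp add: profile_f_def field_simps)
    have "rho powr (2 + \<alpha>) = rho * rho powr (1 + \<alpha>)"
      using rho_pos by (simp add: powr_mult_base)
    then have "p * ((rho * R) powr (1 + \<alpha>) * phi (rho * R) powr p * rho) =
        (p * rho powr (2 + \<alpha>)) * R powr (1 + \<alpha>) * phi (rho * R) powr p"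
      using R rho_pos by (simp add: powr_mult)
    also have "p * rho powr (2 + \<alpha>) = mu / mu powr p" using rho_powr mu_pos by (simp add: field_simps)
    finally show ?thesis unfolding e
      using mu_pos phi_nonneg[of "rho * R"] r by (simp add: powr_divide)
  qed
  ultimately show "(profile_m has_real_derivative R powr (2 + \<alpha> - 1) * (1 + profile_f R / p) powr p) (at R)"
    by simp
qed (use alpha p rho_pos in auto)

section \<open>Bounds for the scale and the maximum\<close>

lemma rho_le: "rho \<le> ((2 + \<alpha>)^2 * p) powr (- 1 / (2 + \<alpha>))"
proof -
  have "((2 + \<alpha>)^2 * p) powr (1 / (2 + \<alpha>)) \<le> ((1 / rho) powr (2 + \<alpha>)) powr (1 / (2 + \<alpha>))"
    using profile.L_powr_ge alpha p by (intro powr_mono2) auto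
  also have "\<dots> = 1 / rho" using alpha rho_pos by (simp add: powr_powr)
  finally have "rho \<le> 1 / ((2 + \<alpha>)^2 * p) powr (1 / (2 + \<alpha>))"
    using alpha p rho_pos by (simp add: field_simps)
  then show ?thesis by (simp add: powr_minus_divide)
qed

text \<open>The logarithm of the definition of \<open>rho\<close>; it transfers bounds on the length
  of the interval to the maximum.\<close>

lemma ln_mu: "(p - 1) * ln mu = (2 + \<alpha>) * ln (1 / rho) - ln p"
  using alpha p mu_pos by (simp add: rho_def ln_powr ln_div ln_mult)

lemma ln_mu_ge: "((p - 1 / (2 + \<alpha>)^2) / 2 - ln p) / (p - 1) \<le> ln mu"
proof -
  \<comment> \<open>\<open>p_le_ln\<close> asks for \<open>1 \<le> 1 / rho\<close>, which follows
    from \<open>L_powr_ge\<close>.\<close>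
  have "1 * 1 \<le> (2 + \<alpha>)^2 * p" using alpha p by (intro mult_mono) (auto intro: one_le_power)
  then have "1 \<le> (1 / rho) powr (2 + \<alpha>)" using profile.L_powr_ge by linarith
  then have "1 \<le> 1 / rho"
    using powr_less_mono2[of "2 + \<alpha>" "1 / rho" 1] alpha rho_pos by (cases "1 / rho < 1") auto
  then have "p \<le> 1 / (2 + \<alpha>)^2 + 2 * (2 + \<alpha>) * ln (1 / rho)" by (rule profile.p_le_ln)
  then have "(p - 1 / (2 + \<alpha>)^2) / 2 - ln p \<le> (p - 1) * ln mu" unfolding ln_mu by argo
  then show ?thesis using p by (simp add: field_simps)
qed

lemma ln_mu_le:
  fixes a defines "a \<equiv> 2 + \<alpha>"
  shows "ln mu \<le> (a * (p * (a / sqrt p + 1 / (1 - 1 / (a^2 * sqrt p)) / (2 * a)) + ln p / (2 * a)) - ln p) / (p - 1)"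
proof -
  have "a * ln (1 / rho) \<le> a * (p * (a / sqrt p + 1 / (1 - 1 / (a^2 * sqrt p)) / (2 * a)) + ln p / (2 * a))"
    unfolding a_def by (rule mult_left_mono[OF profile.ln_L_le]) (use alpha in simp)
  then have "(p - 1) * ln mu \<le> a * (p * (a / sqrt p + 1 / (1 - 1 / (a^2 * sqrt p)) / (2 * a)) + ln p / (2 * a)) - ln p"
    unfolding ln_mu a_def[symmetric] by linarith
  then show ?thesis using p by (subst pos_le_divide_eq) (auto simp: mult.commute)
qed

lemma rescaled_value_error:
  assumes "norm x \<le> A" "A < 1 / rho" "A powr (2 + \<alpha>) < (2 + \<alpha>)^2 * p"
  shows "\<bar>p * (u (rho *\<^sub>R x) - u 0) / u 0 - ln (4 * (2 + \<alpha>)^4 / (2 * (2 + \<alpha>)^2 + norm x powr (2 + \<alpha>))^2)\<bar>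
    \<le> A * bubble_error (2 + \<alpha>) A p"
  using profile.value_error[of "norm x" A] assms rho_pos
  by (simp add: bubble_error_def profile_f_def u_eq[of "rho *\<^sub>R x"] mu_def)

text \<open>Both gradients are multiples of \<open>sgn x\<close>, so the error is that of the
  one-dimensional derivatives.\<close>

lemma rescaled_grad_error:
  assumes x: "norm x \<le> A" "A < 1 / rho" and A: "A powr (2 + \<alpha>) < (2 + \<alpha>)^2 * p"
  shows "norm (grad (\<lambda>x. p * (u (rho *\<^sub>R x) - u 0) / u 0) x
      - grad (\<lambda>x. ln (4 * (2 + \<alpha>)^4 / (2 * (2 + \<alpha>)^2 + norm x powr (2 + \<alpha>))^2)) x)
    \<le> bubble_error (2 + \<alpha>) A p"
proof -
  \<comment> \<open>The chain-rule form of the slope is valid also at the origin, where it is 0; the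
    form with \<open>profile_m\<close> divides by \<open>norm x\<close>.\<close>
  define d where "d = p * (phi' (rho * norm x) * rho - 0) / mu"
  define d' where "d' = - (2 * (2 + \<alpha>) * norm x powr (2 + \<alpha> - 1) / (2 * (2 + \<alpha>)^2 + norm x powr (2 + \<alpha>)))"
  have "norm x < 1 / rho" using x by linarith
  then have r: "rho * norm x < 1" using rho_pos by (simp add: field_simps)
  have "(profile_f has_real_derivative d) (at (norm x))"
  proof -
    have lin: "((\<lambda>R. rho * R) has_real_derivative rho) (at (norm x))" by (auto intro!: derivative_eq_intros)
    have "((\<lambda>R. phi (rho * R)) has_real_derivative phi' (rho * norm x) * rho) (at (norm x))"
      by (rule DERIV_chain2[OF phi_has_derivative lin]) (use r rho_pos in auto)
    then show ?thesis
      unfolding profile_f_def[abs_def] d_def by (intro DERIV_cdivide DERIV_cmult DERIV_diff DERIV_const)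
  qed
  note der = this
  have g1: "grad (\<lambda>x. p * (u (rho *\<^sub>R x) - u 0) / u 0) x = d *\<^sub>R sgn x"
  proof (rule grad_eqI, rule has_derivative_radial[where L = "1 / rho" and f = profile_f])
    show "p * (u (rho *\<^sub>R y) - u 0) / u 0 = profile_f (norm y)" for y
      using rho_pos by (simp add: profile_f_def u_eq[of "rho *\<^sub>R y"] mu_def)
    show "(profile_f has_real_derivative d) (at (norm x) within {0..})"
      by (rule has_field_derivative_at_within[OF der])
  qed (use x in \<open>auto simp: d_def\<close>)
  have g2: "grad (\<lambda>x. ln (4 * (2 + \<alpha>)^4 / (2 * (2 + \<alpha>)^2 + norm x powr (2 + \<alpha>))^2)) x = d' *\<^sub>R sgn x"
  proof (rule grad_eqI, rule has_derivative_radial[where L = "1 / rho"])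
    show "((\<lambda>r. ln (4 * (2 + \<alpha>)^4 / (2 * (2 + \<alpha>)^2 + r powr (2 + \<alpha>))^2)) has_real_derivative d')
        (at (norm x) within {0..})"
      unfolding d'_def by (rule bubble_has_derivative) (use alpha in auto)
  qed (use x in \<open>auto simp: d'_def\<close>)
  show ?thesis
  proof (cases "x = 0")
    case True
    \<comment> \<open>At the origin both gradients vanish, and only nonnegativity of the error bound
      remains.\<close>
    have "A powr (2 + \<alpha>) / ((2 + \<alpha>)^2 * p) < 1" using A alpha p by (simp add: divide_less_eq)
    then have "1 \<le> 1 / (1 - A powr (2 + \<alpha>) / ((2 + \<alpha>)^2 * p))" using p alpha by (simp add: le_divide_eq)
    then have "0 \<le> bubble_error (2 + \<alpha>) A p" unfolding bubble_error_def using alpha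
      by (intro divide_nonneg_nonneg mult_nonneg_nonneg) auto
    then show ?thesis unfolding g1 g2 using True by simp
  next
    case False
    then have "(profile_f has_real_derivative - profile_m (norm x) / norm x) (at (norm x))"
      using x by (intro profile.f_der) auto
    from DERIV_unique[OF der this] have "d = - profile_m (norm x) / norm x" .
    then have "\<bar>d - d'\<bar> \<le> bubble_error (2 + \<alpha>) A p"
      using profile.derivative_error[of "norm x" A] False x A by (simp add: bubble_error_def d'_def)
    then show ?thesis unfolding g1 g2 using False by (simp add: norm_sgn flip: scaleR_diff_left)
  qed
qed

end

theorem theorem1p1:
  fixes \<alpha> :: real and u :: "real \<Rightarrow> real^2 \<Rightarrow> real"
    and \<mu> \<rho> :: "real \<Rightarrow> real" and ut :: "real \<Rightarrow> real^2 \<Rightarrow> real"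
    and U :: "real^2 \<Rightarrow> real"
  assumes "\<alpha> \<ge> 0"
    and "\<And>p. p > 1 \<Longrightarrow> pos_least_energy_radial \<alpha> p (u p)"
    and "\<And>p. \<mu> p = \<bar>u p 0\<bar>"
    and "\<And>p. \<rho> p = (p * \<mu> p powr (p - 1)) powr (- 1 / (2 + \<alpha>))"
    and "\<And>p x. ut p x = p * (u p (\<rho> p *\<^sub>R x) - u p 0) / u p 0"
    and "\<And>x. U x = ln (4 * (2 + \<alpha>)^4 / (2 * (2 + \<alpha>)^2 + norm x powr (2 + \<alpha>))^2)"
  shows "(\<mu> \<longlongrightarrow> sqrt (exp 1)) at_top \<and> (\<rho> \<longlongrightarrow> 0) at_top \<and>
         (\<forall>K. compact K \<longrightarrow>
           (\<forall>\<^sub>F p in at_top. K \<subseteq> ball 0 (1 / \<rho> p)) \<and>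
           uniform_limit K ut U at_top \<and>
           uniform_limit K (\<lambda>p. grad (ut p)) (grad U) at_top)"
proof -
  define a where "a = 2 + \<alpha>"
  have a: "0 < a" using assms(1) by (simp add: a_def)
  have loc: "positive_least_energy \<alpha> p (u p)" if "1 < p" for p
    using assms(1,2) that by (simp add: positive_least_energy_def)
  have mu: "\<mu> p = positive_least_energy.mu (u p)" "0 < \<mu> p" if "1 < p" for p
  proof -
    interpret positive_least_energy \<alpha> p "u p" by (rule loc[OF that])
    show "\<mu> p = mu" "0 < \<mu> p" using mu_pos by (simp_all add: assms(3) mu_def)
  qed
  have rho: "\<rho> p = positive_least_energy.rho \<alpha> p (u p)" if "1 < p" for p
  proof -
    interpret positive_least_energy \<alpha> p "u p" by (rule loc[OF that])
    show "\<rho> p = rho" using mu(1)[OF that] by (simp add: assms(4) rho_def)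
  qed
  have ut: "ut p = (\<lambda>x. p * (u p (\<rho> p *\<^sub>R x) - u p 0) / u p 0)" for p using assms(5) by blast
  have U: "U = (\<lambda>x. ln (4 * (2 + \<alpha>)^4 / (2 * (2 + \<alpha>)^2 + norm x powr (2 + \<alpha>))^2))" using assms(6) by blast
  have gt1: "\<forall>\<^sub>F p::real in at_top. 1 < p" by (rule eventually_gt_at_top)

  \<comment> \<open>In both bounds the terms in \<open>ln p\<close> and \<open>sqrt p\<close> are of
    lower order than \<open>p - 1\<close>, so both tend to 1/2.\<close>
  have "((\<lambda>p. ln (\<mu> p)) \<longlongrightarrow> 1 / 2) at_top"
  proof (rule tendsto_sandwich)
    show "((\<lambda>p. ((p - 1 / a^2) / 2 - ln p) / (p - 1)) \<longlongrightarrow> 1 / 2) at_top"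
      by real_asymp
    show "((\<lambda>p. (a * (p * (a / sqrt p + 1 / (1 - 1 / (a^2 * sqrt p)) / (2 * a)) + ln p / (2 * a)) - ln p) / (p - 1))
        \<longlongrightarrow> 1 / 2) at_top"
      using a by real_asymp
    show "\<forall>\<^sub>F p in at_top. ((p - 1 / a^2) / 2 - ln p) / (p - 1) \<le> ln (\<mu> p)"
      using gt1 by eventually_elim (simp only: mu a_def positive_least_energy.ln_mu_ge[OF loc])
    show "\<forall>\<^sub>F p in at_top. ln (\<mu> p) \<le>
        (a * (p * (a / sqrt p + 1 / (1 - 1 / (a^2 * sqrt p)) / (2 * a)) + ln p / (2 * a)) - ln p) / (p - 1)"
      using gt1 by eventually_elim (simp only: mu a_def positive_least_energy.ln_mu_le[OF loc])
  qed
  then have "((\<lambda>p. exp (ln (\<mu> p))) \<longlongrightarrow> exp (1 / 2)) at_top" by (rule tendsto_exp)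
  moreover have "\<forall>\<^sub>F p in at_top. exp (ln (\<mu> p)) = \<mu> p"
    using gt1 by eventually_elim (simp add: mu(2))
  moreover have "exp (1 / 2) = sqrt (exp (1::real))" 
    by (rule sym, rule real_sqrt_unique) (simp_all add: power2_eq_square flip: exp_add)
  ultimately have lim_mu: "(\<mu> \<longlongrightarrow> sqrt (exp 1)) at_top"
    by (auto intro: Lim_transform_eventually)

  have rho_pos: "0 < \<rho> p" if "1 < p" for p
    using positive_least_energy.rho_pos[OF loc[OF that]] rho[OF that] by simp
  have lim_rho: "(\<rho> \<longlongrightarrow> 0) at_top"
  proof (rule tendsto_sandwich)
    show "\<forall>\<^sub>F p in at_top. 0 \<le> \<rho> p" using gt1 by eventually_elim (use rho_pos in \<open>simp add: less_imp_le\<close>)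
    show "\<forall>\<^sub>F p in at_top. \<rho> p \<le> (a^2 * p) powr (- 1 / a)"
      using gt1 by eventually_elim (simp only: rho a_def positive_least_energy.rho_le[OF loc])
    have "filterlim (\<lambda>p. a^2 * p) at_top at_top"
      by (rule filterlim_tendsto_pos_mult_at_top[OF tendsto_const _ filterlim_ident]) (use a in simp)
    then show "((\<lambda>p. (a^2 * p) powr (- 1 / a)) \<longlongrightarrow> 0) at_top"
      by (intro tendsto_neg_powr) (use a in auto)
  qed simp

  have compact: "(\<forall>\<^sub>F p in at_top. K \<subseteq> ball 0 (1 / \<rho> p)) \<and>
      uniform_limit K ut U at_top \<and> uniform_limit K (\<lambda>p. grad (ut p)) (grad U) at_top"
    if K: "compact K" for K :: "(real^2) set"
  proof -
    obtain A where A: "0 < A" "\<And>x. x \<in> K \<Longrightarrow> norm x \<le> A"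
      using compact_imp_bounded[OF K] unfolding bounded_pos by blast
    have ev1: "\<forall>\<^sub>F p in at_top. \<rho> p < 1 / A" using A by (intro order_tendstoD(2)[OF lim_rho]) auto
    have ev2: "\<forall>\<^sub>F p in at_top. A powr a / a^2 < p" by (rule eventually_gt_at_top)
    \<comment> \<open>For large \<open>p\<close> the ball of radius \<open>A\<close> lies inside the
      rescaled disc and meets the hypotheses of the error estimates, whose bounds do not depend on
      the point of \<open>K\<close>.\<close>
    have ev: "\<forall>\<^sub>F p in at_top. 1 < p \<and> A < 1 / \<rho> p \<and> A powr a < a^2 * p"
      using gt1 ev1 ev2
      by eventually_elim (use rho_pos A a in \<open>auto simp: field_simps\<close>)
    have lim1: "((\<lambda>p. A * bubble_error a A p) \<longlongrightarrow> 0) at_top"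
      using tendsto_mult_right_zero[OF bubble_error_tendsto_0] .
    show ?thesis
    proof (intro conjI uniform_limitI)
      show "\<forall>\<^sub>F p in at_top. K \<subseteq> ball 0 (1 / \<rho> p)"
        using ev by eventually_elim (use A in force)
    next
      fix e :: real assume "0 < e"
      have "\<forall>\<^sub>F p in at_top. A * bubble_error a A p < e" using \<open>0 < e\<close> by (intro order_tendstoD(2)[OF lim1])
      then show "\<forall>\<^sub>F p in at_top. \<forall>x\<in>K. dist (ut p x) (U x) < e"
        using ev
      proof eventually_elim
        case (elim p)
        show ?case
        proof
          fix x assume "x \<in> K"
          then have "\<bar>ut p x - U x\<bar> \<le> A * bubble_error a A p"
            using positive_least_energy.rescaled_value_error[OF loc, of p x A] elim A rho[of p]
            by (simp add: ut U a_def)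
          then show "dist (ut p x) (U x) < e" using elim by (simp add: dist_real_def)
        qed
      qed
    next
      fix e :: real assume "0 < e"
      have "\<forall>\<^sub>F p in at_top. bubble_error a A p < e"
        using \<open>0 < e\<close> by (intro order_tendstoD(2)[OF bubble_error_tendsto_0])
      then show "\<forall>\<^sub>F p in at_top. \<forall>x\<in>K. dist (grad (ut p) x) (grad U x) < e"
        using ev
      proof eventually_elim
        case (elim p)
        show ?case
        proof
          fix x assume "x \<in> K"
          then have "norm (grad (ut p) x - grad U x) \<le> bubble_error a A p"
            using positive_least_energy.rescaled_grad_error[OF loc, of p x A] elim A rho[of p]
            by (simp add: ut U a_def)
          then show "dist (grad (ut p) x) (grad U x) < e" using elim by (simp add: dist_norm)
        qed
      qed
    qed
  qed
  show ?thesis using lim_mu lim_rho compact by blast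
qed

end
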